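(* Let $g_1,\ldots,g_n\in\mathbb{C}[X_1,\ldots,X_n]$ be polynomials of degrees $d_1,\ldots,d_n$ respectively, and let $p\in\mathbb{C}^n$ be an isolated common zero of $g_1,\ldots,g_n$ of multiplicity $r$. Let $N_i$ be the number of monomials of degree at most $d_i$ in the variables $X_1,\ldots,X_n$, and let $N=\sum_{i=1}^n N_i$. Identify $(g_1,\ldots,g_n)$ with its vector of coefficients $\underline{a}\in\mathbb{C}^N$, and for $\underline{\widehat{a}}\in\mathbb{C}^N$ let $(\widehat{g_1},\ldots,\widehat{g_n})$ be the corresponding (perturbed) system of polynomials, with $\widehat{g_i}$ of degree at most $d_i$. Then for all $\epsilon>0$ there exist $\epsilon_1$ with $0<\epsilon_1<\epsilon$ and $\delta_1>0$ such that for all $\underline{\widehat{a}}\in\Omega(\underline{a},\delta_1)$, the perturbed system $(\widehat{g_1},\ldots,\widehat{g_n})$ has only finitely many zeroes in $\Omega(p,\epsilon_1)$; moreover the sum of the multiplicities of these zeroes equals $r$.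
   Context: For $\xi\in\mathbb{C}^m$ and $\epsilon>0$, $\Omega(\xi,\epsilon)=\{\xi'\in\mathbb{C}^m : |\xi_j-\xi'_j|<\epsilon,\ j=1,\ldots,m\}$ is the open polydisc. The multiplicity of a zero $\xi\in\mathbb{C}^n$ of a system $(h_1,\ldots,h_n)$ of polynomials is $\dim_{\mathbb{C}}\left(\mathbb{C}[X_1,\ldots,X_n]/\langle h_1,\ldots,h_n\rangle\right)_{\langle X_1-\xi_1,\ldots,X_n-\xi_n\rangle}$ (finite when $\xi$ is isolated). *)

theory Defs
  imports
    "HOL-Analysis.Analysis"
    "HOL-Algebra.Algebraic_Closure_Type"
    "HOL-Algebra.Embedded_Algebras"
    "HOL-Algebra.QuotRing"
    "HOL-Library.Poly_Mapping"
    "HOL-Library.Extended_Nat"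
begin

section \<open>Complex polynomials in the variables indexed by a finite type\<close>

type_synonym 'n monom = "'n \<Rightarrow>\<^sub>0 nat"
type_synonym 'n cpoly = "'n monom \<Rightarrow>\<^sub>0 complex"

definition Const :: "complex \<Rightarrow> 'n cpoly" where
  "Const c = Poly_Mapping.single 0 c"

definition Var :: "'n \<Rightarrow> 'n cpoly" where
  "Var i = Poly_Mapping.single (Poly_Mapping.single i 1) 1"

definition monom_degree :: "'n::finite monom \<Rightarrow> nat" where
  "monom_degree m = (\<Sum>i\<in>UNIV. Poly_Mapping.lookup m i)"

text \<open>The zero polynomial is given total degree 0.\<close>

definition total_degree :: "'n::finite cpoly \<Rightarrow> nat" where
  "total_degree f = Max (insert 0 (monom_degree ` Poly_Mapping.keys f))"

definition eval_poly :: "'n::finite cpoly \<Rightarrow> ('n \<Rightarrow> complex) \<Rightarrow> complex" where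
  "eval_poly f x =
     (\<Sum>m\<in>Poly_Mapping.keys f. Poly_Mapping.lookup f m * (\<Prod>i\<in>UNIV. x i ^ Poly_Mapping.lookup m i))"

definition common_zeros :: "('k \<Rightarrow> 'n::finite cpoly) \<Rightarrow> ('n \<Rightarrow> complex) set" where
  "common_zeros h = {x. \<forall>i. eval_poly (h i) x = 0}"


section \<open>Polydiscs and coefficient vectors\<close>

text \<open>
  The space of complex vectors indexed by a finite set \<open>J\<close> is represented by the functions that are
  \<^const>\<open>undefined\<close> outside \<open>J\<close>; for \<open>J = UNIV\<close> these are all functions.
\<close>

definition polydisc :: "'j set \<Rightarrow> ('j \<Rightarrow> complex) \<Rightarrow> real \<Rightarrow> ('j \<Rightarrow> complex) set" where
  "polydisc J \<xi> \<epsilon> = {\<xi>' \<in> extensional J. \<forall>j\<in>J. cmod (\<xi> j - \<xi>' j) < \<epsilon>}"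

text \<open>
  The coefficient vector of a system with degree bounds \<open>d i\<close> has one entry for every pair of an
  equation \<open>i\<close> and a monomial of degree at most \<open>d i\<close>.
\<close>

definition coeff_index :: "('k \<Rightarrow> nat) \<Rightarrow> ('k \<times> 'n::finite monom) set" where
  "coeff_index d = (SIGMA i:UNIV. {m. monom_degree m \<le> d i})"

definition coeff_vector ::
  "('k \<Rightarrow> nat) \<Rightarrow> ('k \<Rightarrow> 'n::finite cpoly) \<Rightarrow> ('k \<times> 'n monom) \<Rightarrow> complex" where
  "coeff_vector d g = restrict (\<lambda>(i, m). Poly_Mapping.lookup (g i) m) (coeff_index d)"

definition system_of ::
  "('k \<Rightarrow> nat) \<Rightarrow> (('k \<times> 'n::finite monom) \<Rightarrow> complex) \<Rightarrow> 'k \<Rightarrow> 'n cpoly" where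
  "system_of d a i = (\<Sum>m | monom_degree m \<le> d i. Poly_Mapping.single m (a (i, m)))"

lemma lookup_le_monom_degree: "Poly_Mapping.lookup m i \<le> monom_degree (m :: 'n::finite monom)"
  unfolding monom_degree_def by (rule member_le_sum) auto

lemma finite_monoms_degree_le: "finite {m :: 'n::finite monom. monom_degree m \<le> d}"
proof -
  have "Poly_Mapping.lookup ` {m :: 'n monom. monom_degree m \<le> d} \<subseteq> PiE UNIV (\<lambda>_. {..d})"
    using lookup_le_monom_degree le_trans by fastforce
  moreover have "finite (PiE (UNIV :: 'n set) (\<lambda>_. {..d}))"
    by (intro finite_PiE) auto
  ultimately have "finite (Poly_Mapping.lookup ` {m :: 'n monom. monom_degree m \<le> d})"
    by (rule finite_subset)
  moreover have "inj_on Poly_Mapping.lookup {m :: 'n monom. monom_degree m \<le> d}"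
    by (simp add: inj_on_def lookup_inject)
  ultimately show ?thesis
    by (rule finite_imageD)
qed

lemma finite_coeff_index: "finite (coeff_index d :: ('k::finite \<times> 'n::finite monom) set)"
  unfolding coeff_index_def by (intro finite_SigmaI finite_monoms_degree_le) simp

lemma lookup_system_of:
  "Poly_Mapping.lookup (system_of d a i) m = (if monom_degree m \<le> d i then a (i, m) else 0)"
proof -
  have "Poly_Mapping.lookup (system_of d a i) m =
      (\<Sum>m' | monom_degree m' \<le> d i. if m' = m then a (i, m) else 0)"
    unfolding system_of_def lookup_sum by (intro sum.cong) (auto simp: lookup_single when_def)
  then show ?thesis
    by (simp add: sum.delta' finite_monoms_degree_le)
qed

lemma monom_degree_le_total_degree: "m \<in> Poly_Mapping.keys f \<Longrightarrow> monom_degree m \<le> total_degree f"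
  unfolding total_degree_def by (intro Max_ge) auto

lemma system_of_coeff_vector:
  assumes "\<And>i. total_degree (g i) \<le> d i"
  shows "system_of d (coeff_vector d g) = g"
proof (intro ext poly_mapping_eqI)
  fix i m
  have "Poly_Mapping.lookup (g i) m = 0" if "\<not> monom_degree m \<le> d i"
    using monom_degree_le_total_degree[of m "g i"] assms[of i] that
    by (auto simp: in_keys_iff)
  then show "Poly_Mapping.lookup (system_of d (coeff_vector d g) i) m = Poly_Mapping.lookup (g i) m"
    by (auto simp: lookup_system_of coeff_vector_def coeff_index_def)
qed

lemma coeff_vector_system_of:
  fixes a :: "('k \<times> 'n::finite monom) \<Rightarrow> complex"
  assumes "a \<in> extensional (coeff_index d)"
  shows "coeff_vector d (system_of d a) = a"
proof (rule extensionalityI[where A = "coeff_index d"])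
  fix x :: "'k \<times> 'n monom" assume "x \<in> coeff_index d"
  then show "coeff_vector d (system_of d a) x = a x"
    by (cases x) (auto simp: lookup_system_of coeff_vector_def coeff_index_def)
qed (use assms in \<open>auto simp: coeff_vector_def\<close>)


section \<open>Localization of a commutative ring at a multiplicatively closed set\<close>

definition frac_rel :: "('a, 'b) ring_scheme \<Rightarrow> 'a set \<Rightarrow> (('a \<times> 'a) \<times> ('a \<times> 'a)) set" where
  "frac_rel R S = {((a, s), (b, t)). a \<in> carrier R \<and> b \<in> carrier R \<and> s \<in> S \<and> t \<in> S \<and>
     (\<exists>u\<in>S. u \<otimes>\<^bsub>R\<^esub> (a \<otimes>\<^bsub>R\<^esub> t) = u \<otimes>\<^bsub>R\<^esub> (b \<otimes>\<^bsub>R\<^esub> s))}"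

definition loc_frac :: "('a, 'b) ring_scheme \<Rightarrow> 'a set \<Rightarrow> 'a \<Rightarrow> 'a \<Rightarrow> ('a \<times> 'a) set" where
  "loc_frac R S a s = frac_rel R S `` {(a, s)}"

definition localization :: "('a, 'b) ring_scheme \<Rightarrow> 'a set \<Rightarrow> ('a \<times> 'a) set ring" where
  "localization R S = \<lparr>
     carrier = (carrier R \<times> S) // frac_rel R S,
     mult = (\<lambda>x y. \<Union>(a, s)\<in>x. \<Union>(b, t)\<in>y. loc_frac R S (a \<otimes>\<^bsub>R\<^esub> b) (s \<otimes>\<^bsub>R\<^esub> t)),
     one = loc_frac R S \<one>\<^bsub>R\<^esub> \<one>\<^bsub>R\<^esub>,
     zero = loc_frac R S \<zero>\<^bsub>R\<^esub> \<one>\<^bsub>R\<^esub>,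
     add = (\<lambda>x y. \<Union>(a, s)\<in>x. \<Union>(b, t)\<in>y.
       loc_frac R S (a \<otimes>\<^bsub>R\<^esub> t \<oplus>\<^bsub>R\<^esub> b \<otimes>\<^bsub>R\<^esub> s) (s \<otimes>\<^bsub>R\<^esub> t))\<rparr>"


section \<open>Multiplicity of a zero of a polynomial system\<close>

abbreviation cpoly_ring :: "'n cpoly ring" where
  "cpoly_ring \<equiv> ring_of_type_algebra"

definition quot_ring :: "('k \<Rightarrow> 'n cpoly) \<Rightarrow> 'n cpoly set ring" where
  "quot_ring h = cpoly_ring Quot (Idl\<^bsub>cpoly_ring\<^esub> (range h))"

definition quot_class :: "('k \<Rightarrow> 'n cpoly) \<Rightarrow> 'n cpoly \<Rightarrow> 'n cpoly set" where
  "quot_class h f = (Idl\<^bsub>cpoly_ring\<^esub> (range h)) +>\<^bsub>cpoly_ring\<^esub> f"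

definition ideal_at :: "('k \<Rightarrow> 'n cpoly) \<Rightarrow> ('n \<Rightarrow> complex) \<Rightarrow> 'n cpoly set set" where
  "ideal_at h \<xi> = Idl\<^bsub>quot_ring h\<^esub> (range (\<lambda>i. quot_class h (Var i - Const (\<xi> i))))"

definition denominators_at :: "('k \<Rightarrow> 'n cpoly) \<Rightarrow> ('n \<Rightarrow> complex) \<Rightarrow> 'n cpoly set set" where
  "denominators_at h \<xi> = carrier (quot_ring h) - ideal_at h \<xi>"

definition local_ring ::
  "('k \<Rightarrow> 'n cpoly) \<Rightarrow> ('n \<Rightarrow> complex) \<Rightarrow> ('n cpoly set \<times> 'n cpoly set) set ring" where
  "local_ring h \<xi> = localization (quot_ring h) (denominators_at h \<xi>)"

text \<open>The copy of the complex numbers inside the local ring.\<close>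

definition local_scalars ::
  "('k \<Rightarrow> 'n cpoly) \<Rightarrow> ('n \<Rightarrow> complex) \<Rightarrow> ('n cpoly set \<times> 'n cpoly set) set set" where
  "local_scalars h \<xi> =
     range (\<lambda>c. loc_frac (quot_ring h) (denominators_at h \<xi>) (quot_class h (Const c)) \<one>\<^bsub>quot_ring h\<^esub>)"

text \<open>
  The dimension of the local ring over the complex numbers, \<open>\<infinity>\<close> if it is not finite-dimensional.
  This is meaningful when \<open>\<xi>\<close> is a common zero of \<open>h\<close>; otherwise \<^const>\<open>denominators_at\<close> is empty.
\<close>

definition zero_multiplicity :: "('k \<Rightarrow> 'n cpoly) \<Rightarrow> ('n \<Rightarrow> complex) \<Rightarrow> enat" where
  "zero_multiplicity h \<xi> =
     (let dim_is = (\<lambda>k. ring.dimension (local_ring h \<xi>) k (local_scalars h \<xi>) (carrier (local_ring h \<xi>)))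
      in if \<exists>k. dim_is k then enat (THE k. dim_is k) else \<infinity>)"

end

theory Submission
  imports Defs
begin

text \<open>
  If the \<open>i\<close>-th equation of a system has the form $X_i^E$ plus terms of total degree
  less than \<open>E\<close>, then the monomials with all exponents less than \<open>E\<close> form a basis of the quotient
  algebra, and the matrices of the multiplication operators depend continuously on the coefficients.
  The trace of the multiplication by \<open>f\<close> is the sum of the values of \<open>f\<close> at the zeros, counted with
  multiplicity. Choosing \<open>f\<close> to be 1 at the zeros inside the polydisc and 0 at the others shows that,
  along a segment of such systems without zeros on the boundary of the polydisc, the number of zeros
  inside is constant.

  To reduce to this case, let \<open>W\<close> consist of \<open>p\<close> and finitely many zeros of the perturbed system \<open>g'\<close>
  in the polydisc, and add to the \<open>i\<close>-th equations of both \<open>g\<close> and \<open>g'\<close> the term $t F_i$ with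
  $F_i = \prod_{w \in W} (X_i - w_i)^K$ and \<open>t > 0\<close> small. Since $F_i$ vanishes to high order at the points
  of \<open>W\<close>, by Nakayama's lemma this does not change the local rings there that have finite length,
  and it creates no new zeros near them. As every zero of \<open>g'\<close> in \<open>W\<close> is
  a zero of the modified system, there are at most \<open>r\<close> of them. Hence \<open>W\<close> may contain them all. The local
  rings of the modified system have length at most \<open>r\<close>, and Nakayama's lemma transfers finiteness to
  those of \<open>g'\<close>.
\<close>


section \<open>Evaluation of polynomials\<close>

definition mono_ext :: "('n monom \<Rightarrow> complex) \<Rightarrow> 'n cpoly \<Rightarrow> complex" where
  "mono_ext F f = (\<Sum>m\<in>Poly_Mapping.keys f. Poly_Mapping.lookup f m * F m)"

lemma mono_ext_superset:
  assumes "finite A" "Poly_Mapping.keys f \<subseteq> A"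
  shows "mono_ext F f = (\<Sum>m\<in>A. Poly_Mapping.lookup f m * F m)"
  unfolding mono_ext_def using assms
  by (intro sum.mono_neutral_left) (auto simp: in_keys_iff)

lemma mono_ext_0 [simp]: "mono_ext F 0 = 0"
  by (simp add: mono_ext_def)

lemma mono_ext_single [simp]: "mono_ext F (Poly_Mapping.single m c) = c * F m"
  by (simp add: mono_ext_def)

lemma mono_ext_add: "mono_ext F (f + g) = mono_ext F f + mono_ext F g"
proof -
  let ?A = "Poly_Mapping.keys f \<union> Poly_Mapping.keys g"
  have "mono_ext F (f + g) = (\<Sum>m\<in>?A. Poly_Mapping.lookup (f + g) m * F m)"
    by (rule mono_ext_superset) (auto simp: keys_add)
  then show ?thesis
    by (simp add: mono_ext_superset[of ?A f] mono_ext_superset[of ?A g] lookup_add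
        distrib_right sum.distrib)
qed

lemma cpoly_induct [case_names single add]:
  fixes f :: "'n cpoly"
  assumes single: "\<And>m c. P (Poly_Mapping.single m c)"
    and add: "\<And>f g. P f \<Longrightarrow> P g \<Longrightarrow> P (f + g)"
  shows "P f"
proof -
  have "P (\<Sum>m\<in>A. Poly_Mapping.single m (Poly_Mapping.lookup f m))" if "finite A" for A
    using that
  proof (induction A rule: finite_induct)
    case empty
    show ?case using single[of undefined 0] by simp
  next
    case (insert m A)
    then show ?case using single add by simp
  qed
  moreover have "(\<Sum>m\<in>Poly_Mapping.keys f. Poly_Mapping.single m (Poly_Mapping.lookup f m)) = f"
    by (intro poly_mapping_eqI)
      (simp add: lookup_sum lookup_single when_def sum.delta' in_keys_iff)
  ultimately show ?thesis
    using finite_keys by metis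
qed

lemma Const_0 [simp]: "Const 0 = 0"
  by (simp add: Const_def)

lemma Const_1 [simp]: "Const 1 = 1"
  by (simp add: Const_def)

lemma Const_add: "Const (a + b) = Const a + Const b"
  by (simp add: Const_def single_add)

lemma Const_uminus: "Const (- a) = - Const a"
  by (simp add: Const_def single_uminus)

lemma Const_diff: "Const (a - b) = Const a - Const b"
  by (simp add: Const_def single_diff)

lemma Const_mult: "Const (a * b) = Const a * Const b"
  by (simp add: Const_def mult_single)

lemma Const_inverse_mult: "c \<noteq> 0 \<Longrightarrow> Const (inverse c) * Const c = 1"
  by (simp flip: Const_mult)

lemma Const_times_single: "Const c * Poly_Mapping.single m d = Poly_Mapping.single m (c * d)"
  by (simp add: Const_def mult_single)

lemma mono_ext_Const_mult: "mono_ext F (Const c * f) = c * mono_ext F f"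
  by (induction f rule: cpoly_induct)
    (simp_all add: Const_times_single distrib_left mono_ext_add)

lemma mono_ext_sum: "mono_ext F (sum f A) = (\<Sum>i\<in>A. mono_ext F (f i))"
  by (induction A rule: infinite_finite_induct) (auto simp: mono_ext_add)

lemma mono_ext_uminus: "mono_ext F (- f) = - mono_ext F f"
  using mono_ext_add[of F f "- f"] by (simp add: eq_neg_iff_add_eq_0 add.commute)

lemma mono_ext_diff: "mono_ext F (f - g) = mono_ext F f - mono_ext F g"
  using mono_ext_add[of F f "- g"] by (simp add: mono_ext_uminus)

lemma eval_poly_eq_mono_ext:
  "eval_poly f x = mono_ext (\<lambda>m. \<Prod>i\<in>UNIV. x i ^ Poly_Mapping.lookup m i) f"
  by (simp add: eval_poly_def mono_ext_def)

lemma eval_poly_single: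
  "eval_poly (Poly_Mapping.single m c) x = c * (\<Prod>i\<in>UNIV. x i ^ Poly_Mapping.lookup m i)"
  by (simp add: eval_poly_eq_mono_ext)

lemma eval_poly_0 [simp]: "eval_poly 0 x = 0"
  by (simp add: eval_poly_eq_mono_ext)

lemma eval_poly_add [simp]: "eval_poly (f + g) x = eval_poly f x + eval_poly g x"
  by (simp add: eval_poly_eq_mono_ext mono_ext_add)

lemma eval_poly_uminus [simp]: "eval_poly (- f) x = - eval_poly f x"
  by (simp add: eval_poly_eq_mono_ext mono_ext_uminus)

lemma eval_poly_diff [simp]: "eval_poly (f - g) x = eval_poly f x - eval_poly g x"
  by (simp add: eval_poly_eq_mono_ext mono_ext_diff)

lemma eval_poly_sum [simp]: "eval_poly (sum f A) x = (\<Sum>i\<in>A. eval_poly (f i) x)"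
  by (simp add: eval_poly_eq_mono_ext mono_ext_sum)

lemma eval_poly_Const [simp]: "eval_poly (Const c) x = c"
  by (simp add: Const_def eval_poly_single)

lemma eval_poly_1 [simp]: "eval_poly 1 x = 1"
  using eval_poly_Const[of 1 x] by simp

lemma eval_poly_Var [simp]: "eval_poly (Var i) x = x i"
  by (simp add: Var_def eval_poly_single lookup_single when_def if_distrib[of "power _"] prod.delta cong: if_cong)

lemma eval_poly_mult [simp]: "eval_poly (f * g) x = eval_poly f x * eval_poly g x"
proof (induction f rule: cpoly_induct)
  case (single m c)
  show ?case
    by (induction g rule: cpoly_induct)
      (simp_all add: mult_single eval_poly_single lookup_add power_add prod.distrib distrib_left)
qed (simp add: distrib_right)

lemma eval_poly_power [simp]: "eval_poly (f ^ k) x = eval_poly f x ^ k"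
  by (induction k) auto

lemma eval_poly_prod [simp]: "eval_poly (prod f A) x = (\<Prod>i\<in>A. eval_poly (f i) x)"
  by (induction A rule: infinite_finite_induct) auto

lemma Var_power: "Var i ^ k = Poly_Mapping.single (Poly_Mapping.single i k) 1"
proof (induction k)
  case (Suc k)
  then show ?case
    using mult_single[of "Poly_Mapping.single i 1" "1::complex" "Poly_Mapping.single i k" 1]
    by (simp add: Var_def flip: single_add)
qed simp

lemma prod_single:
  "(\<Prod>i\<in>A. Poly_Mapping.single (m i) (1 :: complex)) = Poly_Mapping.single (\<Sum>i\<in>A. m i) 1"
  by (induction A rule: infinite_finite_induct) (auto simp: mult_single)

lemma single_eq_prod_Var:
  fixes m :: "'n::finite monom"
  shows "Poly_Mapping.single m c = Const c * (\<Prod>i\<in>UNIV. Var i ^ Poly_Mapping.lookup m i)"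
proof -
  have "(\<Sum>i\<in>UNIV. Poly_Mapping.single i (Poly_Mapping.lookup m i)) = m"
    by (intro poly_mapping_eqI) (simp add: lookup_sum lookup_single when_def sum.delta')
  then show ?thesis
    by (simp add: Var_power prod_single Const_times_single)
qed

lemma cpoly_ring_induct [case_names Const Var add mult]:
  fixes f :: "'n::finite cpoly"
  assumes Const: "\<And>c. P (Const c)" and Var: "\<And>i. P (Var i)"
    and add: "\<And>f g. P f \<Longrightarrow> P g \<Longrightarrow> P (f + g)"
    and mult: "\<And>f g. P f \<Longrightarrow> P g \<Longrightarrow> P (f * g)"
  shows "P f"
proof (induction f rule: cpoly_induct)
  case (single m c)
  have 1: "P 1" using Const[of 1] by simp
  have pow: "P (Var i ^ k)" for i k
    by (induction k) (use 1 Var mult in auto)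
  have "P (\<Prod>i\<in>A. Var i ^ Poly_Mapping.lookup m i)" for A
    by (induction A rule: infinite_finite_induct) (use 1 pow mult in auto)
  then show ?case
    unfolding single_eq_prod_Var using Const mult by blast
qed (rule add)


section \<open>Linear algebra modulo a subspace\<close>

interpretation cvec: vector_space "\<lambda>c (f :: 'n cpoly). Const c * f"
  by standard (auto simp: distrib_left distrib_right Const_add Const_mult mult.assoc)

interpretation poly_ideal: Modules.module "(*) :: 'n cpoly \<Rightarrow> 'n cpoly \<Rightarrow> 'n cpoly"
  by standard (auto simp: algebra_simps)

(* as simp rules, these loop with mult.assoc *)
declare cvec.scale_scale [simp del] poly_ideal.scale_scale [simp del]

abbreviation ideal_gen :: "('k \<Rightarrow> 'n cpoly) \<Rightarrow> 'n cpoly set" where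
  "ideal_gen h \<equiv> poly_ideal.span (range h)"

lemma cvec_subspace_ideal: "poly_ideal.subspace I \<Longrightarrow> cvec.subspace I"
  unfolding poly_ideal.subspace_def cvec.subspace_def by blast

lemma cvec_span_ideal: "poly_ideal.subspace I \<Longrightarrow> cvec.span I = I"
  by (simp add: cvec_subspace_ideal)

lemma ideal_eq_UNIV:
  assumes "poly_ideal.subspace I" "1 \<in> I"
  shows "I = UNIV"
  using poly_ideal.subspace_scale[OF assms] by auto

lemma ideal_Const_cancel:
  assumes I: "poly_ideal.subspace I" and c: "c \<noteq> 0" and "Const c * v \<in> I"
  shows "v \<in> I"
proof -
  have "Const (inverse c) * (Const c * v) \<in> I"
    by (rule poly_ideal.subspace_scale[OF I]) fact
  then show ?thesis
    using c by (simp add: Const_inverse_mult flip: mult.assoc)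
qed

fun indep_mod :: "'n cpoly set \<Rightarrow> 'n cpoly list \<Rightarrow> bool" where
  "indep_mod S [] = True"
| "indep_mod S (w # ws) = (w \<notin> cvec.span S \<and> indep_mod (insert w S) ws)"

lemma indep_mod_mono:
  "indep_mod T ws \<Longrightarrow> cvec.span S \<subseteq> cvec.span T \<Longrightarrow> indep_mod S ws"
proof (induction ws arbitrary: S T)
  case (Cons w ws)
  have "cvec.span (insert w S) \<subseteq> cvec.span (insert w T)"
    using Cons.prems(2) unfolding subset_iff cvec.span_breakdown_eq by blast
  then show ?case
    using Cons by auto
qed simp

lemma indep_mod_exchange:
  assumes "indep_mod S ws"
  shows "\<exists>ws'. indep_mod (insert v S) ws' \<and> length ws \<le> Suc (length ws')"
  using assms
proof (induction ws arbitrary: S)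
  case Nil
  then show ?case by (intro exI[of _ "[]"]) simp
next
  case (Cons w ws)
  show ?case
  proof (cases "v \<in> cvec.span (insert w S)")
    case True
    have "cvec.span (insert v S) \<subseteq> cvec.span (insert w S)"
      using True by (intro cvec.span_minimal) (auto intro: cvec.span_base)
    then have "indep_mod (insert v S) ws"
      using Cons.prems indep_mod_mono by auto
    then show ?thesis by auto
  next
    case False
    obtain ws' where ws': "indep_mod (insert v (insert w S)) ws'" "length ws \<le> Suc (length ws')"
      using Cons by auto
    have "w \<notin> cvec.span (insert v S)"
      using False Cons.prems cvec.in_span_insert by auto
    then show ?thesis
      using ws' by (intro exI[of _ "w # ws'"]) (auto simp: insert_commute)
  qed
qed

lemma indep_mod_length_le:
  assumes "indep_mod S ws" "cvec.span (S \<union> set es) = UNIV"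
  shows "length ws \<le> length es"
  using assms
proof (induction es arbitrary: S ws)
  case Nil
  then show ?case by (cases ws) auto
next
  case (Cons e es)
  obtain ws' where "indep_mod (insert e S) ws'" "length ws \<le> Suc (length ws')"
    using indep_mod_exchange[OF Cons.prems(1)] by blast
  then show ?case
    using Cons.IH[of "insert e S" ws'] Cons.prems(2) by simp
qed

lemma indep_mod_append:
  "indep_mod S (ws @ [w]) \<longleftrightarrow> indep_mod S ws \<and> w \<notin> cvec.span (S \<union> set ws)"
  by (induction ws arbitrary: S) auto


section \<open>Composition series\<close>

text \<open>
  A list of points with a chain of ideals from \<open>I\<close> up to the unit ideal whose successive quotients
  are the one-dimensional modules on which \<open>f\<close> acts by its value at the respective point.
\<close>

inductive comp_series :: "'n cpoly set \<Rightarrow> ('n \<Rightarrow> complex) list \<Rightarrow> bool" where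
  UNIV: "comp_series UNIV []"
| step: "comp_series (cvec.span (insert v I)) Q \<Longrightarrow> poly_ideal.subspace I \<Longrightarrow> v \<notin> I \<Longrightarrow>
    (\<And>i. (Var i - Const (q i)) * v \<in> I) \<Longrightarrow> comp_series I (q # Q)"

lemma eigen_mult:
  fixes f :: "'n::finite cpoly"
  assumes I: "poly_ideal.subspace I" and v: "\<And>i. (Var i - Const (q i)) * v \<in> I"
  shows "f * v - Const (eval_poly f q) * v \<in> I"
proof (induction f rule: cpoly_ring_induct)
  case (Const c)
  then show ?case using poly_ideal.subspace_0[OF I] by simp
next
  case (Var i)
  then show ?case using v[of i] by (simp add: left_diff_distrib)
next
  case (add f g)
  then have "(f * v - Const (eval_poly f q) * v) + (g * v - Const (eval_poly g q) * v) \<in> I"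
    by (rule poly_ideal.subspace_add[OF I])
  then show ?case by (simp add: algebra_simps Const_add)
next
  case (mult f g)
  have "f * (g * v - Const (eval_poly g q) * v) + Const (eval_poly g q) * (f * v - Const (eval_poly f q) * v) \<in> I"
    by (intro poly_ideal.subspace_add[OF I] poly_ideal.subspace_scale[OF I] mult.IH)
  then show ?case by (simp add: algebra_simps Const_mult)
qed

lemma in_span_insert_ideal:
  assumes "poly_ideal.subspace I"
  shows "f \<in> cvec.span (insert v I) \<longleftrightarrow> (\<exists>c. f - Const c * v \<in> I)"
  using assms by (simp add: cvec.span_breakdown_eq cvec_span_ideal)

lemma ideal_span_insert:
  fixes v :: "'n::finite cpoly"
  assumes I: "poly_ideal.subspace I" and v: "\<And>i. (Var i - Const (q i)) * v \<in> I"
  shows "poly_ideal.subspace (cvec.span (insert v I))"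
proof (rule poly_ideal.subspaceI)
  fix u f assume "f \<in> cvec.span (insert v I)"
  then obtain c where c: "f - Const c * v \<in> I"
    using I by (auto simp: in_span_insert_ideal)
  have "u * (f - Const c * v) + Const c * (u * v - Const (eval_poly u q) * v) \<in> I"
    by (intro poly_ideal.subspace_add[OF I] poly_ideal.subspace_scale[OF I] c eigen_mult[OF I v])
  then have "u * f - Const (c * eval_poly u q) * v \<in> I"
    by (simp add: algebra_simps Const_mult)
  then show "u * f \<in> cvec.span (insert v I)"
    using I by (auto simp: in_span_insert_ideal)
qed (auto intro: cvec.span_add cvec.span_zero)

lemma comp_series_ideal: "comp_series I Q \<Longrightarrow> poly_ideal.subspace I"
  by (induction rule: comp_series.induct) auto

lemma comp_series_indep:
  assumes "comp_series I Q"
  shows "\<exists>es. length es = length Q \<and> indep_mod I es \<and> cvec.span (I \<union> set es) = UNIV"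
  using assms
proof (induction rule: comp_series.induct)
  case UNIV
  show ?case by simp
next
  case (step v I Q q)
  then obtain es where es: "length es = length Q" "indep_mod (cvec.span (insert v I)) es"
    "cvec.span (cvec.span (insert v I) \<union> set es) = UNIV" by blast
  have "cvec.span (insert v I \<union> set es) = UNIV"
  proof -
    have "cvec.span (insert v I) \<subseteq> cvec.span (insert v I \<union> set es)" "set es \<subseteq> cvec.span (insert v I \<union> set es)"
      by (auto intro: cvec.span_mono[THEN subsetD] cvec.span_base)
    then have "cvec.span (cvec.span (insert v I) \<union> set es) \<subseteq> cvec.span (insert v I \<union> set es)"
      by (intro cvec.span_minimal) auto
    then show ?thesis using es by auto
  qed
  moreover have "indep_mod (insert v I) es"
    using es(2) by (rule indep_mod_mono) (simp add: cvec.span_span)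
  ultimately show ?case
    using step es(1) by (intro exI[of _ "v # es"]) (auto simp: cvec_span_ideal)
qed

lemma comp_series_bound:
  assumes "comp_series I Q" "indep_mod I ws"
  shows "length ws \<le> length Q"
  using comp_series_indep[OF assms(1)] indep_mod_length_le[OF assms(2)] by metis

lemma comp_series_eval:
  fixes f :: "'n::finite cpoly"
  assumes "comp_series I Q" "f \<in> I" "q \<in> set Q"
  shows "eval_poly f q = 0"
  using assms
proof (induction rule: comp_series.induct)
  case (step v I Q q')
  have "f \<in> cvec.span (insert v I)"
    using step.prems(1) by (simp add: cvec.span_base)
  moreover have "eval_poly f q' = 0"
  proof (rule ccontr)
    assume nz: "eval_poly f q' \<noteq> 0"
    have "f * v - (f * v - Const (eval_poly f q') * v) \<in> I"
      using eigen_mult[OF step.hyps(2,4), of f] poly_ideal.subspace_scale[OF step.hyps(2) step.prems(1), of v]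
      by (metis mult.commute poly_ideal.subspace_diff[OF step.hyps(2)])
    then have "Const (eval_poly f q') * v \<in> I"
      by simp
    then show False
      using step.hyps(2,3) nz ideal_Const_cancel by blast
  qed
  ultimately show ?case using step by auto
qed simp

lemma dependent_power:
  fixes x :: "'n cpoly"
  assumes "v \<notin> cvec.span I" and "\<And>ws. indep_mod I ws \<Longrightarrow> length ws \<le> N"
  shows "\<exists>k\<le>N. x ^ k * v \<in> cvec.span (I \<union> (\<lambda>j. x ^ j * v) ` {..<k})"
proof (rule ccontr)
  assume neg: "\<not> ?thesis"
  have "indep_mod I (map (\<lambda>j. x ^ j * v) [0..<k])" if "k \<le> Suc N" for k
    using that
  proof (induction k)
    case (Suc k)
    have "set (map (\<lambda>j. x ^ j * v) [0..<k]) = (\<lambda>j. x ^ j * v) ` {..<k}"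
      by auto
    then show ?case
      using neg Suc by (simp only: upt_Suc_append map_append list.map indep_mod_append) auto
  qed simp
  from this[of "Suc N"] assms(2) show False
    by fastforce
qed

definition uni :: "'n cpoly \<Rightarrow> complex poly \<Rightarrow> 'n cpoly" where
  "uni y P = poly (map_poly Const P) y"

lemma uni_0 [simp]: "uni y 0 = 0"
  by (simp add: uni_def)

lemma uni_pCons [simp]: "uni y (pCons a P) = Const a + y * uni y P"
  by (simp add: uni_def map_poly_pCons)

lemma uni_add: "uni y (P + R) = uni y P + uni y R"
proof (induction P arbitrary: R)
  case (pCons a P)
  then show ?case
    by (cases R) (simp add: Const_add algebra_simps)
qed simp

lemma uni_smult: "uni y (Polynomial.smult c P) = Const c * uni y P"
  by (induction P) (simp_all add: Const_mult algebra_simps)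

lemma uni_diff: "uni y (P - R) = uni y P - uni y R"
  using uni_add[of y "P - R" R] by simp

lemma uni_monom: "uni y (Polynomial.monom c k) = Const c * y ^ k"
  by (induction k) (simp_all add: monom_0 monom_Suc algebra_simps)

lemma eval_poly_uni: "eval_poly (uni y P) q = poly P (eval_poly y q)"
  by (induction P) simp_all

lemma uni_root_times: "uni y ([:- c, 1:] * P) = (y - Const c) * uni y P"
  by (simp add: uni_diff uni_smult algebra_simps)

lemma span_powers:
  assumes I: "poly_ideal.subspace I"
    and k: "y ^ k * v \<in> cvec.span (I \<union> (\<lambda>j. y ^ j * v) ` {..<k})"
  shows "\<exists>P. P \<noteq> 0 \<and> Polynomial.degree P \<le> k \<and> uni y P * v \<in> I"
proof -
  have "\<exists>P. (P = 0 \<or> Polynomial.degree P < n) \<and> f - uni y P * v \<in> I"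
    if "f \<in> cvec.span (I \<union> (\<lambda>j. y ^ j * v) ` {..<n})" for f n
    using that
  proof (induction n arbitrary: f)
    case 0
    then show ?case by (intro exI[of _ 0]) (simp add: cvec_span_ideal[OF I])
  next
    case (Suc n)
    then obtain c where "f - Const c * (y ^ n * v) \<in> cvec.span (I \<union> (\<lambda>j. y ^ j * v) ` {..<n})"
      by (auto simp: lessThan_Suc cvec.span_breakdown_eq)
    then obtain P where P: "P = 0 \<or> Polynomial.degree P < n" "f - Const c * (y ^ n * v) - uni y P * v \<in> I"
      using Suc.IH by blast
    have "Polynomial.degree (P + Polynomial.monom c n) \<le> n"
      using P(1) by (intro degree_add_le) (auto simp: degree_monom_le)
    moreover have "f - uni y (P + Polynomial.monom c n) * v \<in> I"
      using P(2) by (simp add: uni_add uni_monom algebra_simps)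
    ultimately show ?case
      by (intro exI[of _ "P + Polynomial.monom c n"]) auto
  qed
  from this[OF k] obtain P where P: "P = 0 \<or> Polynomial.degree P < k" "y ^ k * v - uni y P * v \<in> I"
    by blast
  have "Polynomial.coeff P k = 0"
    using P(1) by (auto intro: coeff_eq_0)
  then have "Polynomial.coeff (Polynomial.monom 1 k - P) k = 1"
    by simp
  moreover have "Polynomial.degree (Polynomial.monom 1 k - P) \<le> k"
    using P(1) by (intro degree_diff_le) (auto simp: degree_monom_le)
  moreover have "uni y (Polynomial.monom 1 k - P) = y ^ k - uni y P"
    by (simp add: uni_diff uni_monom)
  ultimately show ?thesis
    using P(2) by (intro exI[of _ "Polynomial.monom 1 k - P"]) (auto simp: left_diff_distrib)
qed

lemma eigenvector_of_annihilator:
  assumes I: "poly_ideal.subspace I" and "P \<noteq> 0" "uni y P * v \<in> I" "v \<notin> I"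
  shows "\<exists>c u. u * v \<notin> I \<and> (y - Const c) * (u * v) \<in> I"
  using assms(2-)
proof (induction "Polynomial.degree P" arbitrary: P rule: less_induct)
  case less
  have "Polynomial.degree P \<noteq> 0"
  proof
    assume "Polynomial.degree P = 0"
    then obtain a where "P = [:a:]" "a \<noteq> 0"
      using less.prems(1) by (metis degree_eq_zeroE pCons_0_0)
    then show False
      using less.prems(2,3) ideal_Const_cancel[OF I] by simp
  qed
  then obtain c where "poly P c = 0"
    using fundamental_theorem_of_algebra[of P] constant_degree[of P] by auto
  then obtain R where R: "P = [:- c, 1:] * R"
    by (auto simp: poly_eq_0_iff_dvd)
  have "R \<noteq> 0" using R less.prems(1) by auto
  then have deg: "Polynomial.degree R < Polynomial.degree P"
    unfolding R by (subst degree_mult_eq) auto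
  show ?case
  proof (cases "uni y R * v \<in> I")
    case True
    then show ?thesis
      using less.hyps deg \<open>R \<noteq> 0\<close> less.prems(3) by blast
  next
    case False
    have "uni y P = (y - Const c) * uni y R"
      unfolding R by (rule uni_root_times)
    then show ?thesis
      using False less.prems(2)
      by (intro exI[of _ c] exI[of _ "uni y R"]) (simp add: mult.assoc)
  qed
qed

lemma common_eigenvector:
  fixes I :: "'n::finite cpoly set"
  assumes I: "poly_ideal.subspace I" and "I \<noteq> UNIV"
    and bound: "\<And>ws. indep_mod I ws \<Longrightarrow> length ws \<le> N"
  shows "\<exists>v q. v \<notin> I \<and> (\<forall>i. (Var i - Const (q i)) * v \<in> I)"
proof -
  have "\<exists>v q. v \<notin> I \<and> (\<forall>i\<in>A. (Var i - Const (q i)) * v \<in> I)" if "finite A" for A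
    using that
  proof (induction A rule: finite_induct)
    case empty
    then show ?case using assms(2) by auto
  next
    case (insert i A)
    then obtain v q where v: "v \<notin> I" "\<forall>j\<in>A. (Var j - Const (q j)) * v \<in> I"
      by blast
    obtain k where "Var i ^ k * v \<in> cvec.span (I \<union> (\<lambda>j. Var i ^ j * v) ` {..<k})"
      using dependent_power[of v I N "Var i"] v(1) bound cvec_span_ideal[OF I] by auto
    then obtain P where "P \<noteq> 0" "uni (Var i) P * v \<in> I"
      using span_powers[OF I] by blast
    then obtain c u where u: "u * v \<notin> I" "(Var i - Const c) * (u * v) \<in> I"
      using eigenvector_of_annihilator[OF I _ _ v(1)] by blast
    have "(Var j - Const (q j)) * (u * v) \<in> I" if "j \<in> A" for j
      using poly_ideal.subspace_scale[OF I, of "(Var j - Const (q j)) * v" u] v(2) that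
      by (simp add: mult.left_commute)
    then show ?case
      using u insert.hyps
      by (intro exI[of _ "u * v"] exI[of _ "q(i := c)"]) auto
  qed
  from this[of UNIV] show ?thesis by auto
qed

lemma comp_series_exists:
  fixes I :: "'n::finite cpoly set"
  assumes "poly_ideal.subspace I" and "\<And>ws. indep_mod I ws \<Longrightarrow> length ws \<le> N"
  shows "\<exists>Q. comp_series I Q"
  using assms
proof (induction N arbitrary: I)
  case 0
  have "I = UNIV"
    using 0(2)[of "[1]"] ideal_eq_UNIV[OF 0(1)] cvec_span_ideal[OF 0(1)] by auto
  then show ?case using comp_series.UNIV by blast
next
  case (Suc N)
  show ?case
  proof (cases "I = UNIV")
    case True
    then show ?thesis using comp_series.UNIV by blast
  next
    case False
    obtain v q where v: "v \<notin> I" "\<And>i. (Var i - Const (q i)) * v \<in> I"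
      using common_eigenvector[OF Suc.prems(1) False Suc.prems(2)] by blast
    have "length ws \<le> N" if "indep_mod (cvec.span (insert v I)) ws" for ws
    proof -
      have "indep_mod (insert v I) ws"
        using that by (rule indep_mod_mono) (simp add: cvec.span_span)
      then show ?thesis
        using Suc.prems(2)[of "v # ws"] v(1) cvec_span_ideal[OF Suc.prems(1)] by simp
    qed
    then obtain Q where "comp_series (cvec.span (insert v I)) Q"
      using Suc.IH ideal_span_insert[OF Suc.prems(1) v(2)] by blast
    then show ?thesis
      using comp_series.step Suc.prems(1) v by blast
  qed
qed

section \<open>Localization of ideals\<close>

text \<open>The contraction to the polynomial ring of the extension of \<open>I\<close> to the local ring at \<open>q\<close>.\<close>

definition loc_ideal :: "('n::finite \<Rightarrow> complex) \<Rightarrow> 'n cpoly set \<Rightarrow> 'n cpoly set" where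
  "loc_ideal q I = {f. \<exists>u. eval_poly u q \<noteq> 0 \<and> u * f \<in> I}"

lemma loc_idealI: "eval_poly u q \<noteq> 0 \<Longrightarrow> u * f \<in> I \<Longrightarrow> f \<in> loc_ideal q I"
  by (auto simp: loc_ideal_def)

lemma loc_idealE:
  assumes "f \<in> loc_ideal q I"
  obtains u where "eval_poly u q \<noteq> 0" "u * f \<in> I"
  using assms by (auto simp: loc_ideal_def)

lemma loc_ideal_mono: "I \<subseteq> J \<Longrightarrow> loc_ideal q I \<subseteq> loc_ideal q J"
  by (auto simp: loc_ideal_def)

lemma subset_loc_ideal: "I \<subseteq> loc_ideal q I"
  by (auto intro: loc_idealI[of 1])

lemma loc_ideal_saturated:
  assumes "eval_poly u q \<noteq> 0" "u * f \<in> loc_ideal q I"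
  shows "f \<in> loc_ideal q I"
proof -
  obtain w where "eval_poly w q \<noteq> 0" "w * (u * f) \<in> I"
    using assms(2) by (rule loc_idealE)
  then show ?thesis
    using assms(1) by (intro loc_idealI[of "w * u"]) (auto simp: mult.assoc)
qed

lemma loc_ideal_idem: "loc_ideal q (loc_ideal q I) = loc_ideal q I"
proof
  show "loc_ideal q (loc_ideal q I) \<subseteq> loc_ideal q I"
    using loc_ideal_saturated by (blast elim: loc_idealE)
qed (rule subset_loc_ideal)

lemma subspace_loc_ideal:
  assumes I: "poly_ideal.subspace I"
  shows "poly_ideal.subspace (loc_ideal q I)"
proof (rule poly_ideal.subspaceI)
  show "0 \<in> loc_ideal q I"
    using poly_ideal.subspace_0[OF I] by (auto intro: loc_idealI[of 1])
next
  fix f g assume "f \<in> loc_ideal q I" "g \<in> loc_ideal q I"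
  then obtain u w where u: "eval_poly u q \<noteq> 0" "u * f \<in> I" and w: "eval_poly w q \<noteq> 0" "w * g \<in> I"
    by (auto elim!: loc_idealE)
  have "w * (u * f) + u * (w * g) \<in> I"
    by (intro poly_ideal.subspace_add[OF I] poly_ideal.subspace_scale[OF I] u w)
  then show "f + g \<in> loc_ideal q I"
    using u w by (intro loc_idealI[of "u * w"]) (auto simp: algebra_simps)
next
  fix c f assume "f \<in> loc_ideal q I"
  then obtain u where u: "eval_poly u q \<noteq> 0" "u * f \<in> I"
    by (rule loc_idealE)
  then show "c * f \<in> loc_ideal q I"
    using poly_ideal.subspace_scale[OF I u(2), of c]
    by (intro loc_idealI[of u]) (auto simp: algebra_simps)
qed

lemma comp_series_loc:
  assumes "comp_series I Q"
  shows "comp_series (loc_ideal q I) (filter (\<lambda>x. x = q) Q)"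
  using assms
proof (induction rule: comp_series.induct)
  case UNIV
  have "loc_ideal q UNIV = UNIV" by (auto intro: loc_idealI[of 1])
  then show ?case by (simp add: comp_series.UNIV)
next
  case (step v I Q q')
  note I = step.hyps(2)
  show ?case
  proof (cases "q' = q")
    case False
    then obtain i where i: "q i \<noteq> q' i" by (metis ext)
    have "loc_ideal q (cvec.span (insert v I)) \<subseteq> loc_ideal q I"
    proof
      fix f assume "f \<in> loc_ideal q (cvec.span (insert v I))"
      then obtain u c where u: "eval_poly u q \<noteq> 0" "u * f - Const c * v \<in> I"
        by (auto elim!: loc_idealE simp: in_span_insert_ideal[OF I])
      have "(Var i - Const (q' i)) * (u * f - Const c * v) + Const c * ((Var i - Const (q' i)) * v) \<in> I"
        by (intro poly_ideal.subspace_add[OF I] poly_ideal.subspace_scale[OF I] u step.hyps(4))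
      then have "((Var i - Const (q' i)) * u) * f \<in> I"
        by (simp add: algebra_simps)
      then show "f \<in> loc_ideal q I"
        using i u(1) by (intro loc_idealI) auto
    qed
    moreover have "loc_ideal q I \<subseteq> loc_ideal q (cvec.span (insert v I))"
      by (intro loc_ideal_mono) (auto intro: cvec.span_base)
    ultimately have "loc_ideal q (cvec.span (insert v I)) = loc_ideal q I"
      by (rule equalityI)
    then show ?thesis
      using step.IH False by simp
  next
    case True
    note v = eigen_mult[OF I step.hyps(4), unfolded True]
    have "v \<notin> loc_ideal q I"
    proof
      assume "v \<in> loc_ideal q I"
      then obtain u where u: "eval_poly u q \<noteq> 0" "u * v \<in> I"
        by (rule loc_idealE)
      have "u * v - (u * v - Const (eval_poly u q) * v) \<in> I"
        by (rule poly_ideal.subspace_diff[OF I u(2) v])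
      then have "Const (eval_poly u q) * v \<in> I" by simp
      then show False
        using u(1) step.hyps(3) ideal_Const_cancel[OF I] by blast
    qed
    moreover have "loc_ideal q (cvec.span (insert v I)) = cvec.span (insert v (loc_ideal q I))"
    proof (intro equalityI subsetI)
      fix f assume "f \<in> loc_ideal q (cvec.span (insert v I))"
      then obtain u c where u: "eval_poly u q \<noteq> 0" "u * f - Const c * v \<in> I"
        by (auto elim!: loc_idealE simp: in_span_insert_ideal[OF I])
      let ?c = "c / eval_poly u q"
      have "u * f - Const c * v - Const ?c * (u * v - Const (eval_poly u q) * v) \<in> I"
        by (rule poly_ideal.subspace_diff[OF I u(2)]) (rule poly_ideal.subspace_scale[OF I v])
      moreover have c: "Const c = Const ?c * Const (eval_poly u q)"
        using u(1) by (simp flip: Const_mult)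
      have "u * f - Const c * v - Const ?c * (u * v - Const (eval_poly u q) * v) = u * (f - Const ?c * v)"
        unfolding c by (simp add: algebra_simps)
      ultimately have "u * (f - Const ?c * v) \<in> I"
        by simp
      then have "f - Const ?c * v \<in> loc_ideal q I"
        using u(1) by (intro loc_idealI)
      then show "f \<in> cvec.span (insert v (loc_ideal q I))"
        unfolding in_span_insert_ideal[OF subspace_loc_ideal[OF I]] by blast
    next
      fix f assume "f \<in> cvec.span (insert v (loc_ideal q I))"
      then obtain c where "f - Const c * v \<in> loc_ideal q I"
        unfolding in_span_insert_ideal[OF subspace_loc_ideal[OF I]] by blast
      then obtain u where u: "eval_poly u q \<noteq> 0" "u * (f - Const c * v) \<in> I"
        by (rule loc_idealE)
      have "u * (f - Const c * v) + Const c * (u * v - Const (eval_poly u q) * v) \<in> I"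
        by (intro poly_ideal.subspace_add[OF I u(2)] poly_ideal.subspace_scale[OF I v])
      then have "u * f - Const (c * eval_poly u q) * v \<in> I"
        by (simp add: algebra_simps Const_mult)
      then have "u * f \<in> cvec.span (insert v I)"
        unfolding in_span_insert_ideal[OF I] by blast
      then show "f \<in> loc_ideal q (cvec.span (insert v I))"
        using u(1) by (intro loc_idealI)
    qed
    moreover have "(Var i - Const (q i)) * v \<in> loc_ideal q I" for i
      using step.hyps(4)[of i] subset_loc_ideal True by auto
    ultimately show ?thesis
      using step.IH True subspace_loc_ideal[OF I] by (auto intro!: comp_series.step)
  qed
qed

lemma loc_ideal_zero:
  assumes "\<And>f. f \<in> I \<Longrightarrow> eval_poly f q = 0" "f \<in> loc_ideal q I"
  shows "eval_poly f q = 0"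
  using assms(2) assms(1) by (metis eval_poly_mult loc_idealE mult_eq_0_iff)

lemma eval_poly_ideal_gen:
  assumes "f \<in> ideal_gen h" "q \<in> common_zeros h"
  shows "eval_poly f q = 0"
  using assms(1) by (induction rule: poly_ideal.span_induct_alt)
    (use assms(2) in \<open>auto simp: common_zeros_def\<close>)

lemma comp_series_set:
  assumes "comp_series (ideal_gen h) Q"
  shows "set Q = common_zeros h"
proof (intro equalityI subsetI)
  fix q assume "q \<in> set Q"
  then show "q \<in> common_zeros h"
    using comp_series_eval[OF assms poly_ideal.span_base] by (auto simp: common_zeros_def)
next
  fix q assume q: "q \<in> common_zeros h"
  show "q \<in> set Q"
  proof (rule ccontr)
    assume "q \<notin> set Q"
    then have "filter (\<lambda>x. x = q) Q = []"
      by (auto simp: filter_empty_conv)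
    then have "comp_series (loc_ideal q (ideal_gen h)) []"
      using comp_series_loc[OF assms, of q] by simp
    then have "1 \<in> loc_ideal q (ideal_gen h)"
      by cases auto
    then show False
      using loc_ideal_zero[of "ideal_gen h" q 1] eval_poly_ideal_gen q by fastforce
  qed
qed

text \<open>A polynomial in \<open>y\<close> is a power of \<open>y\<close> times a unit of the local ring at a zero of \<open>y\<close>.\<close>

lemma uni_in_loc_ideal:
  assumes "P \<noteq> 0" "eval_poly y q = 0" "uni y P * w \<in> loc_ideal q I"
  shows "\<exists>j\<le>Polynomial.degree P. y ^ j * w \<in> loc_ideal q I"
  using assms(1,3)
proof (induction P arbitrary: w)
  case (pCons a P)
  show ?case
  proof (cases "a = 0")
    case True
    then have "P \<noteq> 0" "uni y P * (y * w) \<in> loc_ideal q I"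
      using pCons.prems by (auto simp: mult_ac)
    then obtain j where "j \<le> Polynomial.degree P" "y ^ j * (y * w) \<in> loc_ideal q I"
      using pCons.IH by blast
    then show ?thesis
      using \<open>P \<noteq> 0\<close> by (intro exI[of _ "Suc j"]) (auto simp: mult_ac)
  next
    case False
    then have "w \<in> loc_ideal q I"
      using loc_ideal_saturated[OF _ pCons.prems(2)] assms(2) by (simp add: eval_poly_uni)
    then show ?thesis by (intro exI[of _ 0]) auto
  qed
qed simp

lemma power_in_loc_ideal:
  assumes I: "poly_ideal.subspace I" and "eval_poly y q = 0"
    and bound: "\<And>ws. indep_mod (loc_ideal q I) ws \<Longrightarrow> length ws \<le> N"
  shows "y ^ N \<in> loc_ideal q I"
proof (cases "1 \<in> loc_ideal q I")
  case True
  then show ?thesis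
    using ideal_eq_UNIV[OF subspace_loc_ideal[OF I]] by blast
next
  case False
  note L = subspace_loc_ideal[OF I, of q]
  obtain k where "k \<le> N" "y ^ k * 1 \<in> cvec.span (loc_ideal q I \<union> (\<lambda>j. y ^ j * 1) ` {..<k})"
    using dependent_power[of 1 "loc_ideal q I" N y] False bound cvec_span_ideal[OF L] by auto
  then obtain P where "P \<noteq> 0" "Polynomial.degree P \<le> N" "uni y P * 1 \<in> loc_ideal q I"
    using span_powers[OF L] le_trans by blast
  then obtain j where "j \<le> N" "y ^ j \<in> loc_ideal q I"
    using uni_in_loc_ideal[of P y q 1 I] assms(2) le_trans by (metis mult.right_neutral)
  then show ?thesis
    using poly_ideal.subspace_scale[OF L, of "y ^ j" "y ^ (N - j)"] by (simp flip: power_add)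
qed

section \<open>Traces of multiplication operators\<close>

definition dual_system ::
  "'n cpoly set \<Rightarrow> 'b set \<Rightarrow> ('b \<Rightarrow> 'n cpoly) \<Rightarrow> ('b \<Rightarrow> 'n cpoly \<Rightarrow> complex) \<Rightarrow> bool" where
  "dual_system I B e \<phi> \<longleftrightarrow>
     (\<forall>b\<in>B. (\<forall>f g. \<phi> b (f + g) = \<phi> b f + \<phi> b g) \<and> (\<forall>c f. \<phi> b (Const c * f) = c * \<phi> b f) \<and>
        (\<forall>f\<in>I. \<phi> b f = 0)) \<and>
     (\<forall>f. f - (\<Sum>b\<in>B. Const (\<phi> b f) * e b) \<in> I)"

context
  fixes I :: "'n cpoly set" and B e \<phi>
  assumes D: "dual_system I (B :: 'b set) e \<phi>"
begin

lemma dual_system_add: "b \<in> B \<Longrightarrow> \<phi> b (f + g) = \<phi> b f + \<phi> b g"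
  using D by (auto simp: dual_system_def)

lemma dual_system_Const_mult: "b \<in> B \<Longrightarrow> \<phi> b (Const c * f) = c * \<phi> b f"
  using D by (auto simp: dual_system_def)

lemma dual_system_ideal: "b \<in> B \<Longrightarrow> f \<in> I \<Longrightarrow> \<phi> b f = 0"
  using D by (auto simp: dual_system_def)

lemma dual_system_expand: "f - (\<Sum>b\<in>B. Const (\<phi> b f) * e b) \<in> I"
  using D by (auto simp: dual_system_def)

lemma dual_system_diff: "b \<in> B \<Longrightarrow> \<phi> b (f - g) = \<phi> b f - \<phi> b g"
  using dual_system_add[of b "f - g" g] by simp

lemma dual_system_sum: "b \<in> B \<Longrightarrow> \<phi> b (sum f A) = (\<Sum>a\<in>A. \<phi> b (f a))"
  using dual_system_Const_mult[of b 0 0]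
  by (induction A rule: infinite_finite_induct) (auto simp: dual_system_add)

lemma dual_system_cong: "b \<in> B \<Longrightarrow> f - g \<in> I \<Longrightarrow> \<phi> b f = \<phi> b g"
  using dual_system_diff[of b f g] dual_system_ideal[of b "f - g"] by simp

end

lemma dual_system_trace:
  fixes f :: "'n::finite cpoly"
  assumes I: "poly_ideal.subspace I"
    and D: "dual_system I B e \<phi>" and D': "dual_system I B' e' \<phi>'"
  shows "(\<Sum>b\<in>B. \<phi> b (f * e b)) = (\<Sum>b\<in>B'. \<phi>' b (f * e' b))"
proof -
  have "(\<Sum>b\<in>B. \<phi> b (f * e b)) = (\<Sum>b\<in>B. \<Sum>b'\<in>B'. \<phi>' b' (f * e b) * \<phi> b (e' b'))"
    using dual_system_cong[OF D _ dual_system_expand[OF D']]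
    by (intro sum.cong) (auto simp: dual_system_sum[OF D] dual_system_Const_mult[OF D])
  also have "\<dots> = (\<Sum>b'\<in>B'. \<Sum>b\<in>B. \<phi>' b' (f * e b) * \<phi> b (e' b'))"
    by (rule sum.swap)
  also have "\<dots> = (\<Sum>b'\<in>B'. \<phi>' b' (f * e' b'))"
  proof (intro sum.cong refl)
    fix b' assume b': "b' \<in> B'"
    have "f * (e' b' - (\<Sum>b\<in>B. Const (\<phi> b (e' b')) * e b)) \<in> I"
      by (rule poly_ideal.subspace_scale[OF I dual_system_expand[OF D]])
    then have "f * e' b' - (\<Sum>b\<in>B. Const (\<phi> b (e' b')) * (f * e b)) \<in> I"
      by (simp add: right_diff_distrib sum_distrib_left mult.left_commute)
    then have "\<phi>' b' (f * e' b') = \<phi>' b' (\<Sum>b\<in>B. Const (\<phi> b (e' b')) * (f * e b))"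
      by (rule dual_system_cong[OF D' b'])
    then show "(\<Sum>b\<in>B. \<phi>' b' (f * e b) * \<phi> b (e' b')) = \<phi>' b' (f * e' b')"
      using b' by (simp add: dual_system_sum[OF D'] dual_system_Const_mult[OF D']
          mult.commute[of "\<phi>' _ _"])
  qed
  finally show ?thesis .
qed

lemma comp_series_dual_system:
  fixes I :: "'n::finite cpoly set"
  assumes "comp_series I Q"
  shows "\<exists>e \<phi>. dual_system I {..<length Q} e \<phi> \<and>
    (\<forall>k<length Q. \<forall>f. \<phi> k (f * e k) = eval_poly f (Q ! k))"
  using assms
proof (induction rule: comp_series.induct)
  case UNIV
  show ?case by (auto simp: dual_system_def)
next
  case (step v I Q q)
  note I = step.hyps(2)
  let ?J = "cvec.span (insert v I)"
  obtain e \<phi> where D: "dual_system ?J {..<length Q} e \<phi>"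
    and ev: "\<And>k f. k < length Q \<Longrightarrow> \<phi> k (f * e k) = eval_poly f (Q ! k)"
    using step.IH by blast
  define R where "R f = f - (\<Sum>k<length Q. Const (\<phi> k f) * e k)" for f
  have "\<exists>!c. R f - Const c * v \<in> I" for f
  proof -
    have "R f \<in> ?J" unfolding R_def by (rule dual_system_expand[OF D])
    then have "\<exists>c. R f - Const c * v \<in> I"
      by (simp add: in_span_insert_ideal[OF I])
    moreover have "c = c'" if "R f - Const c * v \<in> I" "R f - Const c' * v \<in> I" for c c'
    proof (rule ccontr)
      assume "c \<noteq> c'"
      have "(R f - Const c' * v) - (R f - Const c * v) \<in> I"
        by (rule poly_ideal.subspace_diff[OF I that(2,1)])
      then have "Const (c - c') * v \<in> I"
        by (simp add: Const_diff algebra_simps)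
      then show False
        using \<open>c \<noteq> c'\<close> step.hyps(3) ideal_Const_cancel[OF I] by (metis right_minus_eq)
    qed
    ultimately show ?thesis by blast
  qed
  then obtain \<psi> where \<psi>: "\<And>f c. R f - Const c * v \<in> I \<longleftrightarrow> c = \<psi> f"
    by metis
  have \<psi>_in: "R f - Const (\<psi> f) * v \<in> I" for f
    using \<psi> by blast
  have R_add: "R (f + g) = R f + R g" for f g
    by (simp add: R_def dual_system_add[OF D] Const_add distrib_right sum.distrib)
  have R_Const: "R (Const c * f) = Const c * R f" for c f
    by (simp add: R_def dual_system_Const_mult[OF D] Const_mult right_diff_distrib
        sum_distrib_left mult.assoc)
  have R_J: "R f = f" if "f \<in> ?J" for f
    using that by (simp add: R_def dual_system_ideal[OF D])
  have "\<psi> (f + g) = \<psi> f + \<psi> g" for f g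
  proof -
    have "(R f - Const (\<psi> f) * v) + (R g - Const (\<psi> g) * v) \<in> I"
      by (rule poly_ideal.subspace_add[OF I \<psi>_in \<psi>_in])
    then have "R (f + g) - Const (\<psi> f + \<psi> g) * v \<in> I"
      by (simp add: R_add Const_add algebra_simps)
    then show ?thesis using \<psi> by simp
  qed
  moreover have "\<psi> (Const c * f) = c * \<psi> f" for c f
  proof -
    have "Const c * (R f - Const (\<psi> f) * v) \<in> I"
      by (rule poly_ideal.subspace_scale[OF I \<psi>_in])
    then have "R (Const c * f) - Const (c * \<psi> f) * v \<in> I"
      by (simp add: R_Const Const_mult right_diff_distrib mult.assoc)
    then show ?thesis using \<psi> by simp
  qed
  moreover have "\<psi> f = 0" if "f \<in> I" for f
  proof -
    have "R f - Const 0 * v \<in> I"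
      using that R_J[of f] by (simp add: cvec.span_base)
    then show ?thesis using \<psi>[of f 0] by simp
  qed
  moreover have "\<phi> k f = 0" if "k < length Q" "f \<in> I" for k f
    using that dual_system_ideal[OF D, of k f] by (simp add: cvec.span_base)
  moreover have "f - (Const (\<psi> f) * v + (\<Sum>k<length Q. Const (\<phi> k f) * e k)) \<in> I" for f
    using \<psi>_in[of f] by (simp add: R_def algebra_simps)
  ultimately have "dual_system I {..<length (q # Q)} (case_nat v e) (case_nat \<psi> \<phi>)"
    unfolding dual_system_def length_Cons sum.lessThan_Suc_shift
    by (auto split: nat.split simp: dual_system_add[OF D] dual_system_Const_mult[OF D])
  moreover have "\<psi> (f * v) = eval_poly f q" for f
  proof -
    have "v \<in> ?J" by (simp add: cvec.span_base)
    then have "f * v \<in> ?J"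
      using poly_ideal.subspace_scale[OF ideal_span_insert[OF I step.hyps(4)]] by blast
    then have "R (f * v) - Const (eval_poly f q) * v \<in> I"
      using eigen_mult[OF I step.hyps(4)] R_J by simp
    then show ?thesis using \<psi> by simp
  qed
  ultimately show ?case
    using ev by (intro exI[of _ "case_nat v e"] exI[of _ "case_nat \<psi> \<phi>"])
      (auto split: nat.split simp: less_Suc_eq_0_disj)
qed

lemma trace_comp_series:
  fixes I :: "'n::finite cpoly set"
  assumes "comp_series I Q" "dual_system I B e \<phi>"
  shows "(\<Sum>b\<in>B. \<phi> b (f * e b)) = sum_list (map (eval_poly f) Q)"
proof -
  obtain e' \<phi>' where D: "dual_system I {..<length Q} e' \<phi>'"
    and ev: "\<And>k f. k < length Q \<Longrightarrow> \<phi>' k (f * e' k) = eval_poly f (Q ! k)"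
    using comp_series_dual_system[OF assms(1)] by blast
  have "(\<Sum>b\<in>B. \<phi> b (f * e b)) = (\<Sum>k<length Q. \<phi>' k (f * e' k))"
    by (rule dual_system_trace[OF comp_series_ideal[OF assms(1)] assms(2) D])
  also have "\<dots> = sum_list (map (eval_poly f) Q)"
    by (simp add: ev sum_list_sum_nth atLeast0LessThan)
  finally show ?thesis .
qed


section \<open>Higher order perturbations\<close>

lemma ideal_gen_finite:
  fixes h :: "'k::finite \<Rightarrow> 'n cpoly"
  assumes "f \<in> ideal_gen h"
  shows "\<exists>a. f = (\<Sum>j\<in>UNIV. a j * h j)"
  using assms
proof (induction rule: poly_ideal.span_induct_alt)
  case base
  show ?case by (intro exI[of _ "\<lambda>_. 0"]) simp
next
  case (step c x y)
  then obtain j a where "x = h j" "y = (\<Sum>j\<in>UNIV. a j * h j)" by blast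
  then have "c * x + y = (\<Sum>i\<in>UNIV. (if i = j then c * h i else 0) + a i * h i)"
    by (simp add: sum.distrib sum.delta)
  also have "\<dots> = (\<Sum>i\<in>UNIV. (a i + (if i = j then c else 0)) * h i)"
    by (intro sum.cong) (auto simp: algebra_simps)
  finally show ?case
    by (intro exI[of _ "\<lambda>i. a i + (if i = j then c else 0)"])
qed

lemma nakayama:
  fixes w :: "'j \<Rightarrow> 'n::finite cpoly"
  assumes "finite J" "poly_ideal.subspace G"
    and "\<And>j. j \<in> J \<Longrightarrow> \<exists>u c. eval_poly u q \<noteq> 0 \<and> (\<forall>k\<in>J. eval_poly (c k) q = 0) \<and>
      u * w j - (\<Sum>k\<in>J. c k * w k) \<in> G"
    and "j \<in> J"
  shows "w j \<in> loc_ideal q G"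
  using assms(1,3,4)
proof (induction J arbitrary: j rule: finite_induct)
  case (insert i J)
  note G = assms(2)
  note L = subspace_loc_ideal[OF G, of q]
  obtain u0 c0 where u0: "eval_poly u0 q \<noteq> 0" "\<And>k. k \<in> insert i J \<Longrightarrow> eval_poly (c0 k) q = 0"
    and "u0 * w i - (\<Sum>k\<in>insert i J. c0 k * w k) \<in> G"
    using insert.prems(1)[of i] by auto
  define v where "v = u0 - c0 i"
  have v: "eval_poly v q \<noteq> 0" using u0 by (simp add: v_def)
  have vw: "v * w i - (\<Sum>k\<in>J. c0 k * w k) \<in> G"
    using \<open>u0 * w i - _ \<in> G\<close> insert.hyps by (simp add: v_def algebra_simps)
  have IH: "w j \<in> loc_ideal q G" if "j \<in> J" for j
  proof (rule insert.IH[OF _ that])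
    fix j assume "j \<in> J"
    then obtain u c where u: "eval_poly u q \<noteq> 0" "\<And>k. k \<in> insert i J \<Longrightarrow> eval_poly (c k) q = 0"
      and uw: "u * w j - (\<Sum>k\<in>insert i J. c k * w k) \<in> G"
      using insert.prems(1)[of j] by auto
    have "v * (u * w j - (\<Sum>k\<in>insert i J. c k * w k)) + c i * (v * w i - (\<Sum>k\<in>J. c0 k * w k)) \<in> G"
      by (intro poly_ideal.subspace_add[OF G] poly_ideal.subspace_scale[OF G] uw vw)
    then have "(v * u) * w j - (\<Sum>k\<in>J. (v * c k + c i * c0 k) * w k) \<in> G"
      using insert.hyps by (simp add: algebra_simps sum.distrib sum_distrib_left)
    then show "\<exists>u c. eval_poly u q \<noteq> 0 \<and> (\<forall>k\<in>J. eval_poly (c k) q = 0) \<and>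
        u * w j - (\<Sum>k\<in>J. c k * w k) \<in> G"
      using u u0 v by (intro exI[of _ "v * u"] exI[of _ "\<lambda>k. v * c k + c i * c0 k"]) auto
  qed
  have "(v * w i - (\<Sum>k\<in>J. c0 k * w k)) + (\<Sum>k\<in>J. c0 k * w k) \<in> loc_ideal q G"
    using vw subset_loc_ideal IH
    by (intro poly_ideal.subspace_add[OF L] poly_ideal.subspace_sum[OF L] poly_ideal.subspace_scale[OF L]) auto
  then have "w i \<in> loc_ideal q G"
    using loc_ideal_saturated[OF v] by simp
  then show ?case
    using insert.prems(2) IH by auto
qed simp

lemma ideal_gen_minimal:
  "(\<And>i. h i \<in> I) \<Longrightarrow> poly_ideal.subspace I \<Longrightarrow> ideal_gen h \<subseteq> I"
  by (intro poly_ideal.span_minimal) auto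

lemma in_ideal_gen: "h i \<in> ideal_gen h"
  by (simp add: poly_ideal.span_base)

lemma sum_in_ideal_gen: "(\<Sum>j\<in>A. a j * h j) \<in> ideal_gen h"
  by (intro poly_ideal.span_sum poly_ideal.span_scale in_ideal_gen)

lemma continuous_on_eval_poly [continuous_intros]:
  fixes f :: "'n::finite cpoly"
  shows "continuous_on S (eval_poly f)"
proof -
  have "continuous_on UNIV (\<lambda>x. eval_poly f x)"
    by (induction f rule: cpoly_ring_induct) (simp_all add: continuous_intros)
  then show ?thesis
    using continuous_on_subset by blast
qed

context
  fixes g F R :: "'n::finite \<Rightarrow> 'n cpoly" and q :: "'n \<Rightarrow> complex" and k :: nat
  assumes F: "\<And>i. F i = (Var i - Const (q i)) ^ Suc k * R i"
begin

lemma power_in_loc_ideal_unperturb: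
  assumes "\<And>i. (Var i - Const (q i)) ^ k \<in> loc_ideal q (ideal_gen (\<lambda>i. g i + Const t * F i))"
  shows "(Var i - Const (q i)) ^ k \<in> loc_ideal q (ideal_gen g)"
proof (rule nakayama[where J = UNIV and w = "\<lambda>i. (Var i - Const (q i)) ^ k"])
  fix j
  obtain u where u1: "eval_poly u q \<noteq> 0"
    "u * (Var j - Const (q j)) ^ k \<in> ideal_gen (\<lambda>i. g i + Const t * F i)"
    using assms[of j] by (rule loc_idealE)
  then obtain a where u: "eval_poly u q \<noteq> 0"
    "u * (Var j - Const (q j)) ^ k = (\<Sum>i\<in>UNIV. a i * (g i + Const t * F i))"
    using ideal_gen_finite[OF u1(2)] by blast
  have "u * (Var j - Const (q j)) ^ k
      - (\<Sum>i\<in>UNIV. (a i * Const t * (Var i - Const (q i)) * R i) * (Var i - Const (q i)) ^ k)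
      = (\<Sum>i\<in>UNIV. a i * g i)"
    unfolding u(2) sum_subtractf[symmetric] F by (intro sum.cong) (auto simp: algebra_simps)
  also have "\<dots> \<in> ideal_gen g"
    by (rule sum_in_ideal_gen)
  finally show "\<exists>u c. eval_poly u q \<noteq> 0 \<and> (\<forall>k\<in>UNIV. eval_poly (c k) q = 0) \<and>
      u * (Var j - Const (q j)) ^ k - (\<Sum>i\<in>UNIV. c i * (Var i - Const (q i)) ^ k) \<in> ideal_gen g"
    using u(1) by (intro exI[of _ u] exI[of _ "\<lambda>i. a i * Const t * (Var i - Const (q i)) * R i"]) auto
qed auto

context
  assumes pow: "\<And>i. (Var i - Const (q i)) ^ k \<in> loc_ideal q (ideal_gen g)"
begin

lemma perturbation_matrix:
  "\<exists>u m. \<forall>i. eval_poly (u i) q \<noteq> 0 \<and> (\<forall>j. eval_poly (m i j) q = 0) \<and>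
    u i * F i = (\<Sum>j\<in>UNIV. m i j * g j)"
proof -
  have "\<exists>u m. eval_poly u q \<noteq> 0 \<and> (\<forall>j. eval_poly (m j) q = 0) \<and>
      u * F i = (\<Sum>j\<in>UNIV. m j * g j)" for i
  proof -
    obtain u where u1: "eval_poly u q \<noteq> 0" "u * (Var i - Const (q i)) ^ k \<in> ideal_gen g"
      using pow[of i] by (rule loc_idealE)
    then obtain a where u: "eval_poly u q \<noteq> 0" "u * (Var i - Const (q i)) ^ k = (\<Sum>j\<in>UNIV. a j * g j)"
      using ideal_gen_finite[OF u1(2)] by blast
    have "u * F i = (Var i - Const (q i)) * R i * (u * (Var i - Const (q i)) ^ k)"
      by (simp add: F algebra_simps)
    also have "\<dots> = (\<Sum>j\<in>UNIV. ((Var i - Const (q i)) * R i * a j) * g j)"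
      unfolding u(2) by (simp add: sum_distrib_left mult.assoc)
    finally show ?thesis
      using u(1) by (intro exI[of _ u] exI[of _ "\<lambda>j. (Var i - Const (q i)) * R i * a j"]) auto
  qed
  then show ?thesis by metis
qed

lemma loc_ideal_perturb:
  "loc_ideal q (ideal_gen (\<lambda>i. g i + Const t * F i)) = loc_ideal q (ideal_gen g)"
proof -
  let ?h = "\<lambda>i. g i + Const t * F i"
  note L = subspace_loc_ideal[OF poly_ideal.subspace_span, of q]
  obtain u m where u: "\<And>i. eval_poly (u i) q \<noteq> 0" and m: "\<And>i j. eval_poly (m i j) q = 0"
    and um: "\<And>i. u i * F i = (\<Sum>j\<in>UNIV. m i j * g j)"
    using perturbation_matrix by metis
  have "F i \<in> loc_ideal q (ideal_gen g)" for i
    using u um sum_in_ideal_gen by (intro loc_idealI[of "u i"]) auto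
  then have "?h i \<in> loc_ideal q (ideal_gen g)" for i
    using in_ideal_gen[of g i] subset_loc_ideal
    by (intro poly_ideal.subspace_add[OF L] poly_ideal.subspace_scale[OF L]) auto
  then have 1: "ideal_gen ?h \<subseteq> loc_ideal q (ideal_gen g)"
    by (intro ideal_gen_minimal L)
  have "g j \<in> loc_ideal q (ideal_gen ?h)" for j
  proof (rule nakayama[where J = UNIV and w = g])
    fix j
    have "u j * g j - (\<Sum>i\<in>UNIV. (- Const t * m j i) * g i) = u j * g j + Const t * (u j * F j)"
      unfolding um by (simp add: sum_distrib_left sum_negf mult.assoc)
    also have "\<dots> = u j * ?h j"
      by (simp add: algebra_simps)
    also have "\<dots> \<in> ideal_gen ?h"
      using poly_ideal.span_scale in_ideal_gen by fast
    finally show "\<exists>u c. eval_poly u q \<noteq> 0 \<and> (\<forall>i\<in>UNIV. eval_poly (c i) q = 0) \<and>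
        u * g j - (\<Sum>i\<in>UNIV. c i * g i) \<in> ideal_gen ?h"
      using u m by (intro exI[of _ "u j"] exI[of _ "\<lambda>i. - Const t * m j i"]) auto
  qed auto
  then have 2: "ideal_gen g \<subseteq> loc_ideal q (ideal_gen ?h)"
    by (intro ideal_gen_minimal L)
  show ?thesis
    using loc_ideal_mono[OF 1, of q] loc_ideal_mono[OF 2, of q] by (simp add: loc_ideal_idem)
qed

lemma perturb_zeros_near:
  "\<exists>U. open U \<and> q \<in> U \<and>
    (\<forall>t x. cmod t \<le> 1 \<longrightarrow> x \<in> U \<longrightarrow> x \<in> common_zeros (\<lambda>i. g i + Const t * F i) \<longrightarrow> x \<in> common_zeros g)"
proof -
  obtain u m where u: "\<And>i. eval_poly (u i) q \<noteq> 0" and m: "\<And>i j. eval_poly (m i j) q = 0"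
    and um: "\<And>i. u i * F i = (\<Sum>j\<in>UNIV. m i j * g j)"
    using perturbation_matrix by metis
  define U where "U = (\<Inter>i. {x. (\<Sum>j\<in>UNIV. cmod (eval_poly (m i j) x)) < cmod (eval_poly (u i) x)})"
  have "open U"
    unfolding U_def by (intro open_INT finite ballI open_Collect_less continuous_intros)
  moreover have "q \<in> U"
    using u m by (simp add: U_def)
  moreover have "x \<in> common_zeros g"
    if t: "cmod t \<le> 1" and x: "x \<in> U" "x \<in> common_zeros (\<lambda>i. g i + Const t * F i)" for t x
  proof -
    define M where "M = Max (range (\<lambda>i. cmod (eval_poly (g i) x)))"
    have le: "cmod (eval_poly (g j) x) \<le> M" for j
      unfolding M_def by (intro Max_ge) auto
    have "M \<in> range (\<lambda>i. cmod (eval_poly (g i) x))"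
      unfolding M_def by (intro Max_in) auto
    then obtain i where i: "M = cmod (eval_poly (g i) x)" by blast
    have "eval_poly (g i) x = - t * eval_poly (F i) x"
      using x(2) by (auto simp: common_zeros_def add_eq_0_iff)
    then have "cmod (eval_poly (u i) x) * M = cmod t * cmod (eval_poly (u i * F i) x)"
      unfolding i by (simp add: norm_mult)
    also have "\<dots> \<le> 1 * (\<Sum>j\<in>UNIV. cmod (eval_poly (m i j) x) * cmod (eval_poly (g j) x))"
      unfolding um using t
      by (intro mult_mono) (auto simp flip: norm_mult intro!: sum_norm_le)
    also have "\<dots> \<le> (\<Sum>j\<in>UNIV. cmod (eval_poly (m i j) x)) * M"
      unfolding sum_distrib_right mult_1 by (intro sum_mono mult_left_mono le) auto
    finally have "M \<le> 0"
      using x(1) by (auto simp: U_def mult_le_cancel_right not_less[symmetric])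
    then have "cmod (eval_poly (g j) x) \<le> 0" for j
      using le[of j] by linarith
    then show ?thesis by (simp add: common_zeros_def)
  qed
  ultimately show ?thesis by blast
qed

end

end

section \<open>The local ring of a system at a zero\<close>

lemma comp_series_length_unique:
  assumes "comp_series I Q" "comp_series I Q'"
  shows "length Q = length Q'"
proof -
  have "length Q \<le> length Q'" if "comp_series I Q" "comp_series I Q'" for Q Q'
    using comp_series_indep[OF that(1)] comp_series_bound[OF that(2)] by metis
  then show ?thesis
    using assms by (intro antisym)
qed

lemma comp_series_unit:
  fixes u :: "'n::finite cpoly"
  assumes "comp_series I Q" "\<And>q. q \<in> set Q \<Longrightarrow> eval_poly u q \<noteq> 0"
  shows "\<exists>f. a - f * u \<in> I"
  using assms
proof (induction rule: comp_series.induct)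
  case (step v I Q q)
  note I = step.hyps(2)
  obtain f where "a - f * u \<in> cvec.span (insert v I)"
    using step by auto
  then obtain c where c: "a - f * u - Const c * v \<in> I"
    by (auto simp: in_span_insert_ideal[OF I])
  define e where "e = eval_poly u q"
  have e: "e \<noteq> 0" using step.prems by (simp add: e_def)
  have "a - f * u - Const c * v - Const (c / e) * (u * v - Const e * v) \<in> I"
    unfolding e_def
    by (rule poly_ideal.subspace_diff[OF I c])
      (rule poly_ideal.subspace_scale[OF I eigen_mult[OF I step.hyps(4)]])
  moreover have eq: "Const c = Const (c / e) * Const e"
    using e by (simp flip: Const_mult)
  have "a - f * u - Const c * v - Const (c / e) * (u * v - Const e * v) = a - (f + Const (c / e) * v) * u"
    unfolding eq by (simp add: algebra_simps)
  ultimately show ?case by metis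
qed auto

lemma cpoly_ring_simps [simp]:
  "carrier cpoly_ring = UNIV" "x \<otimes>\<^bsub>cpoly_ring\<^esub> y = x * y" "x \<oplus>\<^bsub>cpoly_ring\<^esub> y = x + y"
  "\<one>\<^bsub>cpoly_ring\<^esub> = 1" "\<zero>\<^bsub>cpoly_ring\<^esub> = 0"
  by (simp_all add: ring_of_type_algebra_def)

lemma ideal_cpoly_ring_iff:
  fixes I :: "'n cpoly set"
  shows "ideal I cpoly_ring \<longleftrightarrow> poly_ideal.subspace I"
proof
  assume "ideal I cpoly_ring"
  then interpret J: ideal I cpoly_ring .
  show "poly_ideal.subspace I"
    using additive_subgroup.zero_closed[OF J.additive_subgroup_axioms]
      additive_subgroup.a_closed[OF J.additive_subgroup_axioms] J.I_l_closed
    by (auto intro!: poly_ideal.subspaceI)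
next
  assume I: "poly_ideal.subspace I"
  interpret R: cring "cpoly_ring :: 'n cpoly ring" by (rule cring_from_type_algebra)
  have "\<ominus>\<^bsub>cpoly_ring\<^esub> x = - x" for x :: "'n cpoly"
    by (rule R.minus_equality) auto
  then show "ideal I cpoly_ring"
    using poly_ideal.subspace_neg[OF I] poly_ideal.subspace_add[OF I] poly_ideal.subspace_0[OF I]
      poly_ideal.subspace_scale[OF I]
    by (intro idealI R.ring_axioms R.add.subgroupI) (auto simp: a_inv_def mult.commute)
qed

lemma genideal_eq_ideal_gen: "Idl\<^bsub>cpoly_ring\<^esub> (range h) = ideal_gen h"
  unfolding genideal_def ideal_cpoly_ring_iff
  by (intro equalityI Inter_greatest Inter_lower poly_ideal.span_minimal)
    (auto intro: poly_ideal.span_base)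

lemma quot_class_eq_iff: "quot_class h f = quot_class h g \<longleftrightarrow> f - g \<in> ideal_gen h"
proof
  assume "quot_class h f = quot_class h g"
  moreover have "0 + f \<in> quot_class h f"
    unfolding quot_class_def genideal_eq_ideal_gen a_r_coset_def' using poly_ideal.span_zero by force
  ultimately obtain i where "i \<in> ideal_gen h" "f = i + g"
    by (auto simp: quot_class_def genideal_eq_ideal_gen a_r_coset_def')
  then show "f - g \<in> ideal_gen h" by simp
next
  assume d: "f - g \<in> ideal_gen h"
  have "quot_class h f \<subseteq> quot_class h g" if "f - g \<in> ideal_gen h" for f g
  proof
    fix x assume "x \<in> quot_class h f"
    then obtain i where "i \<in> ideal_gen h" "x = i + f"
      by (auto simp: quot_class_def genideal_eq_ideal_gen a_r_coset_def')
    then have "i + (f - g) \<in> ideal_gen h" "x = (i + (f - g)) + g"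
      using poly_ideal.span_add that by auto
    then show "x \<in> quot_class h g"
      unfolding quot_class_def genideal_eq_ideal_gen a_r_coset_def'
      by (auto intro!: bexI[of _ "i + (f - g)"])
  qed
  moreover have "g - f \<in> ideal_gen h"
    using poly_ideal.span_neg[OF d] by simp
  ultimately show "quot_class h f = quot_class h g"
    using d by blast
qed

lemma ideal_ideal_gen: "ideal (ideal_gen h) cpoly_ring"
  by (simp add: ideal_cpoly_ring_iff)

lemma quot_ring_cring: "cring (quot_ring h)"
  unfolding quot_ring_def genideal_eq_ideal_gen
  by (rule ideal.quotient_is_cring[OF ideal_ideal_gen]) (rule cring_from_type_algebra)

lemma carrier_quot_ring: "carrier (quot_ring h) = range (quot_class h)"
  by (auto simp: quot_ring_def quot_class_def FactRing_def A_RCOSETS_def')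

lemma quot_class_carrier [simp]: "quot_class h f \<in> carrier (quot_ring h)"
  by (simp add: carrier_quot_ring)

lemma quot_class_hom: "quot_class h \<in> ring_hom cpoly_ring (quot_ring h)"
  unfolding quot_ring_def genideal_eq_ideal_gen
  using ideal.rcos_ring_hom[OF ideal_ideal_gen] by (simp add: quot_class_def[abs_def] genideal_eq_ideal_gen)

lemma quot_class_mult: "quot_class h f \<otimes>\<^bsub>quot_ring h\<^esub> quot_class h g = quot_class h (f * g)"
  using ring_hom_mult[OF quot_class_hom[of h], of f g] by simp

lemma quot_class_add: "quot_class h f \<oplus>\<^bsub>quot_ring h\<^esub> quot_class h g = quot_class h (f + g)"
  using ring_hom_add[OF quot_class_hom[of h], of f g] by simp

lemma quot_class_1: "\<one>\<^bsub>quot_ring h\<^esub> = quot_class h 1"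
  using ring_hom_one[OF quot_class_hom[of h]] by simp

lemma quot_class_0: "\<zero>\<^bsub>quot_ring h\<^esub> = quot_class h 0"
proof -
  interpret Q: cring "quot_ring h" by (rule quot_ring_cring)
  have "quot_class h 0 \<oplus>\<^bsub>quot_ring h\<^esub> quot_class h 0 = quot_class h 0"
    by (simp add: quot_class_add)
  then show ?thesis
    using Q.add.r_cancel_one' by (metis quot_class_carrier)
qed

lemma UN_UN_eq_const:
  assumes "A \<noteq> {}" "B \<noteq> {}"
    and "\<And>a s b t. (a, s) \<in> A \<Longrightarrow> (b, t) \<in> B \<Longrightarrow> f a s b t = C"
  shows "(\<Union>(a, s)\<in>A. \<Union>(b, t)\<in>B. f a s b t) = C"
  using assms by fastforce

context
  fixes h :: "'k \<Rightarrow> 'n::finite cpoly" and q :: "'n \<Rightarrow> complex"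
  assumes q: "q \<in> common_zeros h"
begin

lemma quot_class_in_ideal_at: "quot_class h f \<in> ideal_at h q \<longleftrightarrow> eval_poly f q = 0"
proof
  interpret Q: cring "quot_ring h" by (rule quot_ring_cring)
  let ?V = "{f. eval_poly f q = 0}"
  have minus: "\<ominus>\<^bsub>quot_ring h\<^esub> quot_class h f = quot_class h (- f)" for f
    by (rule Q.minus_equality) (simp_all add: quot_class_add quot_class_0)
  have "ideal (quot_class h ` ?V) (quot_ring h)"
  proof (intro idealI Q.ring_axioms Q.add.subgroupI)
    show "quot_class h ` ?V \<noteq> {}"
      by (auto intro!: exI[of _ 0])
  next
    fix a x assume "a \<in> quot_class h ` ?V" "x \<in> carrier (quot_ring h)"
    then show "x \<otimes>\<^bsub>quot_ring h\<^esub> a \<in> quot_class h ` ?V" "a \<otimes>\<^bsub>quot_ring h\<^esub> x \<in> quot_class h ` ?V"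
      by (auto simp: carrier_quot_ring quot_class_mult)
  qed (auto simp: quot_class_add minus)
  then have "ideal_at h q \<subseteq> quot_class h ` ?V"
    unfolding ideal_at_def by (rule Q.genideal_minimal) auto
  moreover assume "quot_class h f \<in> ideal_at h q"
  ultimately obtain f' where f': "eval_poly f' q = 0" "f - f' \<in> ideal_gen h"
    by (auto simp: quot_class_eq_iff)
  then show "eval_poly f q = 0"
    using eval_poly_ideal_gen[OF f'(2) q] by simp
next
  interpret Q: cring "quot_ring h" by (rule quot_ring_cring)
  interpret J: ideal "ideal_at h q" "quot_ring h"
    unfolding ideal_at_def by (rule Q.genideal_ideal) auto
  let ?K = "{f. quot_class h f \<in> ideal_at h q}"
  assume "eval_poly f q = 0"
  have "poly_ideal.subspace ?K"
  proof (rule poly_ideal.subspaceI)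
    fix x y assume "x \<in> ?K" "y \<in> ?K"
    then show "x + y \<in> ?K" by (auto simp flip: quot_class_add)
  next
    fix c x assume "x \<in> ?K"
    then show "c * x \<in> ?K" by (auto simp: J.I_l_closed simp flip: quot_class_mult)
  qed (use J.zero_closed in \<open>simp add: quot_class_0\<close>)
  moreover have "(Var i - Const (q i)) * 1 \<in> ?K" for i
  proof -
    have "range (\<lambda>i. quot_class h (Var i - Const (q i))) \<subseteq> ideal_at h q"
      unfolding ideal_at_def by (rule Q.genideal_self) auto
    then show ?thesis by auto
  qed
  ultimately have "f * 1 - Const (eval_poly f q) * 1 \<in> ?K"
    by (rule eigen_mult)
  then show "quot_class h f \<in> ideal_at h q"
    using \<open>eval_poly f q = 0\<close> by simp
qed

lemma quot_class_in_denominators_at: "quot_class h f \<in> denominators_at h q \<longleftrightarrow> eval_poly f q \<noteq> 0"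
  by (simp add: denominators_at_def quot_class_in_ideal_at)

lemma denominators_atE:
  assumes "x \<in> denominators_at h q"
  obtains u where "eval_poly u q \<noteq> 0" "x = quot_class h u"
  using assms by (auto simp: denominators_at_def carrier_quot_ring quot_class_in_ideal_at)

definition poly_frac where
  "poly_frac a s = loc_frac (quot_ring h) (denominators_at h q) (quot_class h a) (quot_class h s)"

abbreviation loc_gen where "loc_gen \<equiv> loc_ideal q (ideal_gen h)"

lemma subspace_loc_gen: "poly_ideal.subspace loc_gen"
  by (simp add: subspace_loc_ideal)

lemma in_poly_frac_iff:
  assumes "eval_poly s q \<noteq> 0"
  shows "(quot_class h b, quot_class h t) \<in> poly_frac a s \<longleftrightarrow> eval_poly t q \<noteq> 0 \<and> a * t - b * s \<in> loc_gen"
proof -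
  have "(\<exists>u\<in>denominators_at h q. u \<otimes>\<^bsub>quot_ring h\<^esub> (quot_class h a \<otimes>\<^bsub>quot_ring h\<^esub> quot_class h t) =
      u \<otimes>\<^bsub>quot_ring h\<^esub> (quot_class h b \<otimes>\<^bsub>quot_ring h\<^esub> quot_class h s)) \<longleftrightarrow>
      (\<exists>u. eval_poly u q \<noteq> 0 \<and> u * (a * t) - u * (b * s) \<in> ideal_gen h)"
    using quot_class_in_denominators_at
    by (auto elim!: denominators_atE simp: quot_class_mult quot_class_eq_iff)
      (use quot_class_in_denominators_at quot_class_eq_iff quot_class_mult in metis)
  then show ?thesis
    using assms
    by (simp add: poly_frac_def loc_frac_def frac_rel_def quot_class_in_denominators_at loc_ideal_def
        right_diff_distrib)
qed

lemma poly_fracE: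
  assumes "(x, y) \<in> poly_frac a s" "eval_poly s q \<noteq> 0"
  obtains b t where "x = quot_class h b" "y = quot_class h t" "eval_poly t q \<noteq> 0" "a * t - b * s \<in> loc_gen"
proof -
  have "x \<in> carrier (quot_ring h)" "y \<in> denominators_at h q"
    using assms(1) by (auto simp: poly_frac_def loc_frac_def frac_rel_def)
  then obtain b t where "x = quot_class h b" "y = quot_class h t"
    by (auto simp: carrier_quot_ring elim!: denominators_atE)
  then show ?thesis
    using assms in_poly_frac_iff that by simp
qed

lemma poly_frac_eq_iff:
  assumes s: "eval_poly s q \<noteq> 0" and t: "eval_poly t q \<noteq> 0"
  shows "poly_frac a s = poly_frac b t \<longleftrightarrow> a * t - b * s \<in> loc_gen"
proof
  assume "poly_frac a s = poly_frac b t"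
  moreover have "(quot_class h b, quot_class h t) \<in> poly_frac b t"
    using t poly_ideal.subspace_0[OF subspace_loc_gen] by (simp add: in_poly_frac_iff)
  ultimately have "(quot_class h b, quot_class h t) \<in> poly_frac a s"
    by simp
  then show "a * t - b * s \<in> loc_gen"
    using in_poly_frac_iff[OF s] by simp
next
  have sub: "poly_frac a s \<subseteq> poly_frac b t"
    if s: "eval_poly s q \<noteq> 0" and t: "eval_poly t q \<noteq> 0" and d: "a * t - b * s \<in> loc_gen" for a b s t
  proof clarify
    fix x y assume "(x, y) \<in> poly_frac a s"
    then obtain c v where cv: "x = quot_class h c" "y = quot_class h v" "eval_poly v q \<noteq> 0"
      and av: "a * v - c * s \<in> loc_gen"
      using s by (rule poly_fracE)
    have "t * (a * v - c * s) - v * (a * t - b * s) \<in> loc_gen"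
      by (rule poly_ideal.subspace_diff[OF subspace_loc_gen])
        (rule poly_ideal.subspace_scale[OF subspace_loc_gen], fact)+
    then have "s * (b * v - c * t) \<in> loc_gen"
      by (simp add: algebra_simps)
    then show "(x, y) \<in> poly_frac b t"
      using cv t in_poly_frac_iff loc_ideal_saturated[OF s] by auto
  qed
  assume d: "a * t - b * s \<in> loc_gen"
  have "b * s - a * t \<in> loc_gen"
    using poly_ideal.subspace_neg[OF subspace_loc_gen d] by simp
  then show "poly_frac a s = poly_frac b t"
    using sub[OF s t d] sub[OF t s] by blast
qed

lemma carrier_local_ring:
  "carrier (local_ring h q) = {poly_frac a s | a s. eval_poly s q \<noteq> 0}"
  by (fastforce simp: local_ring_def localization_def quotient_def poly_frac_def loc_frac_def
      carrier_quot_ring quot_class_in_denominators_at elim!: denominators_atE)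

lemma poly_frac_carrier: "eval_poly s q \<noteq> 0 \<Longrightarrow> poly_frac a s \<in> carrier (local_ring h q)"
  by (auto simp: carrier_local_ring)

lemma poly_frac_nonempty: "eval_poly s q \<noteq> 0 \<Longrightarrow> poly_frac a s \<noteq> {}"
  using in_poly_frac_iff[of s a s a] poly_ideal.subspace_0[OF subspace_loc_gen] by auto

lemma poly_frac_mult:
  assumes s: "eval_poly s q \<noteq> 0" and t: "eval_poly t q \<noteq> 0"
  shows "poly_frac a s \<otimes>\<^bsub>local_ring h q\<^esub> poly_frac b t = poly_frac (a * b) (s * t)"
  unfolding local_ring_def localization_def monoid.simps ring.simps
proof (rule UN_UN_eq_const[OF poly_frac_nonempty poly_frac_nonempty, OF s t])
  fix x y x' y' assume "(x, y) \<in> poly_frac a s" "(x', y') \<in> poly_frac b t"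
  then obtain c v c' v' where c: "x = quot_class h c" "y = quot_class h v"
      "x' = quot_class h c'" "y' = quot_class h v'"
    and v: "eval_poly v q \<noteq> 0" "eval_poly v' q \<noteq> 0"
    and d: "a * v - c * s \<in> loc_gen" "b * v' - c' * t \<in> loc_gen"
    using s t by (metis poly_fracE)
  have "b * v' * (a * v - c * s) + c * s * (b * v' - c' * t) \<in> loc_gen"
    by (intro poly_ideal.subspace_add[OF subspace_loc_gen] poly_ideal.subspace_scale[OF subspace_loc_gen] d)
  then have "poly_frac (a * b) (s * t) = poly_frac (c * c') (v * v')"
    using s t v by (simp add: poly_frac_eq_iff algebra_simps)
  then show "loc_frac (quot_ring h) (denominators_at h q) (x \<otimes>\<^bsub>quot_ring h\<^esub> x') (y \<otimes>\<^bsub>quot_ring h\<^esub> y') =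
      poly_frac (a * b) (s * t)"
    unfolding c quot_class_mult by (simp add: poly_frac_def)
qed

lemma poly_frac_add:
  assumes s: "eval_poly s q \<noteq> 0" and t: "eval_poly t q \<noteq> 0"
  shows "poly_frac a s \<oplus>\<^bsub>local_ring h q\<^esub> poly_frac b t = poly_frac (a * t + b * s) (s * t)"
  unfolding local_ring_def localization_def monoid.simps ring.simps
proof (rule UN_UN_eq_const[OF poly_frac_nonempty poly_frac_nonempty, OF s t])
  fix x y x' y' assume "(x, y) \<in> poly_frac a s" "(x', y') \<in> poly_frac b t"
  then obtain c v c' v' where c: "x = quot_class h c" "y = quot_class h v"
      "x' = quot_class h c'" "y' = quot_class h v'"
    and v: "eval_poly v q \<noteq> 0" "eval_poly v' q \<noteq> 0"
    and d: "a * v - c * s \<in> loc_gen" "b * v' - c' * t \<in> loc_gen"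
    using s t by (metis poly_fracE)
  have "t * v' * (a * v - c * s) + s * v * (b * v' - c' * t) \<in> loc_gen"
    by (intro poly_ideal.subspace_add[OF subspace_loc_gen] poly_ideal.subspace_scale[OF subspace_loc_gen] d)
  then have "poly_frac (a * t + b * s) (s * t) = poly_frac (c * v' + c' * v) (v * v')"
    using s t v by (simp add: poly_frac_eq_iff algebra_simps)
  then show "loc_frac (quot_ring h) (denominators_at h q)
      (x \<otimes>\<^bsub>quot_ring h\<^esub> y' \<oplus>\<^bsub>quot_ring h\<^esub> x' \<otimes>\<^bsub>quot_ring h\<^esub> y) (y \<otimes>\<^bsub>quot_ring h\<^esub> y') =
      poly_frac (a * t + b * s) (s * t)"
    unfolding c quot_class_mult quot_class_add by (simp add: poly_frac_def)
qed

lemma poly_frac_1: "\<one>\<^bsub>local_ring h q\<^esub> = poly_frac 1 1"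
  by (simp add: local_ring_def localization_def poly_frac_def quot_class_1)

lemma poly_frac_0: "\<zero>\<^bsub>local_ring h q\<^esub> = poly_frac 0 1"
  by (simp add: local_ring_def localization_def poly_frac_def quot_class_1 quot_class_0)

lemma loc_gen_0: "f = 0 \<Longrightarrow> f \<in> loc_gen"
  using poly_ideal.subspace_0[OF subspace_loc_gen] by simp

lemma local_ringE:
  assumes "x \<in> carrier (local_ring h q)"
  obtains a s where "x = poly_frac a s" "eval_poly s q \<noteq> 0"
  using assms by (auto simp: carrier_local_ring)

lemma local_ring_cring: "cring (local_ring h q)"
proof (intro cringI abelian_groupI comm_monoidI)
  fix x assume "x \<in> carrier (local_ring h q)"
  then obtain a s where x: "x = poly_frac a s" "eval_poly s q \<noteq> 0"
    by (rule local_ringE)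
  have "poly_frac (- a) s \<oplus>\<^bsub>local_ring h q\<^esub> x = \<zero>\<^bsub>local_ring h q\<^esub>"
    unfolding x poly_frac_0 using x(2) by (simp add: poly_frac_add poly_frac_eq_iff loc_gen_0)
  then show "\<exists>y\<in>carrier (local_ring h q). y \<oplus>\<^bsub>local_ring h q\<^esub> x = \<zero>\<^bsub>local_ring h q\<^esub>"
    using x(2) poly_frac_carrier by blast
qed (elim local_ringE,
  simp_all add: poly_frac_0 poly_frac_1 poly_frac_add poly_frac_mult poly_frac_eq_iff poly_frac_carrier
    loc_gen_0 algebra_simps)+

definition to_local where "to_local f = poly_frac f 1"

lemma to_local_eq_iff: "to_local f = to_local g \<longleftrightarrow> f - g \<in> loc_gen"
  by (simp add: to_local_def poly_frac_eq_iff)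

lemma to_local_carrier [simp]: "to_local f \<in> carrier (local_ring h q)"
  by (simp add: to_local_def poly_frac_carrier)

lemma to_local_mult: "to_local f \<otimes>\<^bsub>local_ring h q\<^esub> to_local g = to_local (f * g)"
  by (simp add: to_local_def poly_frac_mult)

lemma to_local_add: "to_local f \<oplus>\<^bsub>local_ring h q\<^esub> to_local g = to_local (f + g)"
  by (simp add: to_local_def poly_frac_add)

lemma local_scalars_eq: "local_scalars h q = range (\<lambda>c. to_local (Const c))"
  by (simp add: local_scalars_def to_local_def poly_frac_def quot_class_1)

lemma subfield_local_scalars: "subfield (local_scalars h q) (local_ring h q)"
proof -
  let ?C = "ring_of_type_algebra :: complex ring"
  interpret L: cring "local_ring h q" by (rule local_ring_cring)
  interpret C: field ?C by (rule field_from_type_algebra)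
  interpret hom: ring_hom_ring ?C "local_ring h q" "\<lambda>c. to_local (Const c)"
    by (intro ring_hom_ringI C.ring_axioms L.ring_axioms)
      (simp_all add: ring_of_type_algebra_def to_local_mult to_local_add Const_mult Const_add,
        simp add: to_local_def poly_frac_1)
  have "1 \<notin> loc_gen"
    using loc_ideal_zero[of "ideal_gen h" q 1] eval_poly_ideal_gen[OF _ q] by auto
  then have "\<one>\<^bsub>local_ring h q\<^esub> \<noteq> \<zero>\<^bsub>local_ring h q\<^esub>"
    by (simp add: poly_frac_0 poly_frac_1 poly_frac_eq_iff)
  from hom.img_is_subfield(2)[OF C.carrier_is_subfield this]
  show ?thesis
    by (simp add: local_scalars_eq ring_of_type_algebra_def)
qed

lemma to_local_line_extension:
  assumes "loc_gen \<subseteq> V"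
  shows "ring.line_extension (local_ring h q) (local_scalars h q) (to_local u) (to_local ` cvec.span V) =
    to_local ` cvec.span (insert u V)"
proof -
  interpret L: cring "local_ring h q" by (rule local_ring_cring)
  show ?thesis
  proof (intro equalityI subsetI)
    fix x assume "x \<in> L.line_extension (local_scalars h q) (to_local u) (to_local ` cvec.span V)"
    then obtain c f where f: "f \<in> cvec.span V"
      and x: "x = to_local (Const c) \<otimes>\<^bsub>local_ring h q\<^esub> to_local u \<oplus>\<^bsub>local_ring h q\<^esub> to_local f"
      by (auto simp: L.line_extension_mem_iff local_scalars_eq)
    have "Const c * u + f \<in> cvec.span (insert u V)"
      using f by (auto simp: cvec.span_breakdown_eq intro!: exI[of _ c])
    then show "x \<in> to_local ` cvec.span (insert u V)"
      unfolding x to_local_mult to_local_add by blast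
  next
    fix x assume "x \<in> to_local ` cvec.span (insert u V)"
    then obtain f c where f: "x = to_local f" "f - Const c * u \<in> cvec.span V"
      by (auto simp: cvec.span_breakdown_eq)
    have "x = to_local (Const c) \<otimes>\<^bsub>local_ring h q\<^esub> to_local u \<oplus>\<^bsub>local_ring h q\<^esub> to_local (f - Const c * u)"
      unfolding to_local_mult to_local_add f(1) by simp
    then show "x \<in> L.line_extension (local_scalars h q) (to_local u) (to_local ` cvec.span V)"
      using f(2) unfolding L.line_extension_mem_iff local_scalars_eq by blast
  qed
qed

lemma to_local_in_image:
  assumes "cvec.subspace V" "loc_gen \<subseteq> V"
  shows "to_local f \<in> to_local ` V \<longleftrightarrow> f \<in> V"
proof
  assume "to_local f \<in> to_local ` V"
  then obtain g where "g \<in> V" "f - g \<in> V"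
    using assms(2) by (auto simp: to_local_eq_iff)
  then show "f \<in> V"
    using cvec.subspace_add[OF assms(1), of "f - g" g] by simp
qed auto

lemma to_local_loc_gen: "to_local ` loc_gen = {\<zero>\<^bsub>local_ring h q\<^esub>}"
proof -
  have "to_local ` loc_gen = {to_local 0}"
    using loc_gen_0[of 0] to_local_eq_iff[of _ 0] by (intro equalityI subsetI) auto
  then show ?thesis
    by (simp add: poly_frac_0 to_local_def)
qed

lemma dimension_bound:
  assumes dim: "ring.dimension (local_ring h q) k (local_scalars h q) (carrier (local_ring h q))"
    and "indep_mod loc_gen ws"
  shows "length ws \<le> k"
proof -
  interpret L: cring "local_ring h q" by (rule local_ring_cring)
  have span: "L.Span (local_scalars h q) (map to_local us) = to_local ` cvec.span (loc_gen \<union> set us)" for us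
  proof (induction us)
    case Nil
    show ?case
      by (simp add: cvec_span_ideal[OF subspace_loc_gen] to_local_loc_gen)
  next
    case (Cons u us)
    then show ?case
      using to_local_line_extension[of "loc_gen \<union> set us" u] by simp
  qed
  have "L.independent (local_scalars h q) (map to_local us)" if "indep_mod loc_gen (rev us)" for us
    using that
  proof (induction us)
    case (Cons u us)
    have "loc_gen \<subseteq> cvec.span (loc_gen \<union> set us)"
      using cvec.span_superset by blast
    then show ?case
      using Cons unfolding list.map
      by (intro L.li_Cons) (auto simp: span indep_mod_append to_local_in_image simp del: L.Span.simps)
  qed simp
  from this[of "rev ws"] assms(2) have "L.independent (local_scalars h q) (map to_local (rev ws))"
    by simp
  moreover have "set (map to_local (rev ws)) \<subseteq> carrier (local_ring h q)"
    by auto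
  ultimately show ?thesis
    using L.independent_length_le_dimension[OF subfield_local_scalars dim] by fastforce
qed

lemma dimension_of_comp_series:
  assumes "comp_series loc_gen Q"
  shows "ring.dimension (local_ring h q) (length Q) (local_scalars h q) (carrier (local_ring h q))"
proof -
  interpret L: cring "local_ring h q" by (rule local_ring_cring)
  have "L.dimension (k + length Q) (local_scalars h q) (range to_local)"
    if "comp_series J Q" "loc_gen \<subseteq> J" "L.dimension k (local_scalars h q) (to_local ` J)" for J Q k
    using that
  proof (induction arbitrary: k rule: comp_series.induct)
    case (step v I Q q')
    have sp: "cvec.span I = I" by (rule cvec_span_ideal) fact
    have v: "to_local v \<notin> to_local ` I"
      using to_local_in_image[of I v] step.prems(1) step.hyps(3) cvec_subspace_ideal[OF step.hyps(2)] by simp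
    then have "L.dimension (Suc k) (local_scalars h q) (to_local ` cvec.span (insert v I))"
      using L.Suc_dim[OF to_local_carrier v step.prems(2)] to_local_line_extension[OF step.prems(1), of v] sp
      by simp
    moreover have "loc_gen \<subseteq> cvec.span (insert v I)"
      using step.prems(1) cvec.span_superset by blast
    ultimately show ?case
      using step.IH by fastforce
  qed simp
  from this[OF assms, of 0] have "L.dimension (length Q) (local_scalars h q) (range to_local)"
    using L.zero_dim by (simp add: to_local_loc_gen)
  moreover have "carrier (local_ring h q) = range to_local"
  proof (intro equalityI subsetI)
    fix x assume "x \<in> carrier (local_ring h q)"
    then obtain a s where x: "x = poly_frac a s" "eval_poly s q \<noteq> 0"
      by (auto simp: carrier_local_ring)
    have "comp_series loc_gen (filter (\<lambda>x. x = q) Q)"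
      using comp_series_loc[OF assms, of q] by (simp add: loc_ideal_idem)
    then obtain f where "a - f * s \<in> loc_gen"
      using comp_series_unit[of loc_gen "filter (\<lambda>x. x = q) Q" s a] x(2) by auto
    then have "x = to_local f"
      using x by (simp add: to_local_def poly_frac_eq_iff)
    then show "x \<in> range to_local" by blast
  qed auto
  ultimately show ?thesis by simp
qed

lemma zero_multiplicity_comp_series:
  assumes "comp_series loc_gen Q"
  shows "zero_multiplicity h q = enat (length Q)"
proof -
  interpret L: cring "local_ring h q" by (rule local_ring_cring)
  note dim = dimension_of_comp_series[OF assms]
  have "(THE k. L.dimension k (local_scalars h q) (carrier (local_ring h q))) = length Q"
    using dim L.dimension_is_inj[OF subfield_local_scalars] by blast
  then show ?thesis
    using dim by (auto simp: zero_multiplicity_def Let_def)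
qed

lemma zero_multiplicity_finite:
  assumes "zero_multiplicity h q = enat r"
  shows "\<exists>Q. comp_series loc_gen Q \<and> length Q = r"
proof -
  obtain k where "ring.dimension (local_ring h q) k (local_scalars h q) (carrier (local_ring h q))"
    using assms by (auto simp: zero_multiplicity_def Let_def split: if_splits)
  then obtain Q where "comp_series loc_gen Q"
    using comp_series_exists[OF subspace_loc_gen] dimension_bound by blast
  then show ?thesis
    using zero_multiplicity_comp_series assms by auto
qed

end

section \<open>Systems with leading monomials that are pure powers\<close>

lemma monom_degree_add: "monom_degree (a + b) = monom_degree a + monom_degree b"
  by (simp add: monom_degree_def lookup_add sum.distrib)

lemma monom_degree_single: "monom_degree (Poly_Mapping.single i k) = k"
  by (simp add: monom_degree_def lookup_single when_def sum.delta')

lemma monom_split: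
  fixes \<alpha> :: "'n monom"
  assumes "k \<le> Poly_Mapping.lookup \<alpha> i"
  shows "\<alpha> - Poly_Mapping.single i k + Poly_Mapping.single i k = \<alpha>"
  using assms by (intro poly_mapping_eqI) (auto simp: lookup_add lookup_minus lookup_single when_def)

definition monic_system ::
  "nat \<Rightarrow> ('n \<Rightarrow> 'n monom \<Rightarrow> complex) \<Rightarrow> 'n \<Rightarrow> 'n::finite cpoly" where
  "monic_system E c i = Var i ^ E + (\<Sum>m | monom_degree m < E. Poly_Mapping.single m (c i m))"

lemma finite_monoms_degree_less: "finite {m :: 'n::finite monom. monom_degree m < E}"
  by (rule finite_subset[OF _ finite_monoms_degree_le[of E]]) auto

definition reduced_monoms :: "nat \<Rightarrow> 'n::finite monom set" where
  "reduced_monoms E = {m. \<forall>i. Poly_Mapping.lookup m i < E}"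

lemma finite_reduced_monoms: "finite (reduced_monoms E :: 'n::finite monom set)"
proof (rule finite_subset[OF _ finite_monoms_degree_le])
  show "reduced_monoms E \<subseteq> {m :: 'n monom. monom_degree m \<le> (\<Sum>i\<in>(UNIV :: 'n set). E)}"
  proof
    fix m :: "'n monom" assume "m \<in> reduced_monoms E"
    then have "monom_degree m \<le> (\<Sum>i\<in>(UNIV :: 'n set). E)"
      unfolding monom_degree_def by (intro sum_mono less_imp_le) (simp add: reduced_monoms_def)
    then show "m \<in> {m. monom_degree m \<le> (\<Sum>i\<in>(UNIV :: 'n set). E)}" by simp
  qed
qed

definition reducible_index :: "nat \<Rightarrow> 'n monom \<Rightarrow> 'n" where
  "reducible_index E \<alpha> = (SOME i. E \<le> Poly_Mapping.lookup \<alpha> i)"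

lemma reducible_index:
  assumes "\<alpha> \<notin> reduced_monoms E"
  shows "E \<le> Poly_Mapping.lookup \<alpha> (reducible_index E \<alpha>)"
  unfolding reducible_index_def
  by (rule someI_ex) (use assms in \<open>auto simp: reduced_monoms_def not_less\<close>)

lemma monom_degree_reduce:
  assumes "\<alpha> \<notin> reduced_monoms E" "monom_degree \<gamma> < E"
  shows "monom_degree (\<alpha> - Poly_Mapping.single (reducible_index E \<alpha>) E + \<gamma>) < monom_degree \<alpha>"
proof -
  let ?i = "reducible_index E \<alpha>"
  have "monom_degree (\<alpha> - Poly_Mapping.single ?i E) + E = monom_degree \<alpha>"
    using monom_split[OF reducible_index[OF assms(1)]] by (metis monom_degree_add monom_degree_single)
  then show ?thesis
    using assms(2) by (simp add: monom_degree_add)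
qed

text \<open>The coefficient at \<open>\<beta>\<close> of the normal form of the monomial \<open>\<alpha>\<close> modulo \<^term>\<open>monic_system E c\<close>.\<close>

function normal_form ::
  "nat \<Rightarrow> ('n \<Rightarrow> 'n monom \<Rightarrow> complex) \<Rightarrow> 'n monom \<Rightarrow> 'n::finite monom \<Rightarrow> complex" where
  "normal_form E c \<beta> \<alpha> =
    (if \<alpha> \<in> reduced_monoms E then if \<alpha> = \<beta> then 1 else 0
     else - (\<Sum>\<gamma> | monom_degree \<gamma> < E. c (reducible_index E \<alpha>) \<gamma> *
       normal_form E c \<beta> (\<alpha> - Poly_Mapping.single (reducible_index E \<alpha>) E + \<gamma>)))"
  by auto
termination
  by (relation "Wellfounded.measure (\<lambda>(E, c, \<beta>, \<alpha>). monom_degree \<alpha>)") (auto intro: monom_degree_reduce)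

declare normal_form.simps [simp del]

text \<open>
  If the rewriting of a monomial uses another equation than the \<open>i\<close>-th, then the difference is
  resolved by the trivial syzygy between the two equations.
\<close>

lemma normal_form_relation:
  fixes \<alpha> :: "'n::finite monom"
  shows "normal_form E c \<beta> (\<alpha> + Poly_Mapping.single i E) +
    (\<Sum>\<gamma> | monom_degree \<gamma> < E. c i \<gamma> * normal_form E c \<beta> (\<alpha> + \<gamma>)) = 0"
proof (induction "monom_degree \<alpha>" arbitrary: \<alpha> i rule: less_induct)
  case less
  let ?N = "normal_form E c \<beta>" and ?G = "{\<gamma> :: 'n monom. monom_degree \<gamma> < E}"
  define A where "A = \<alpha> + Poly_Mapping.single i E"
  define j where "j = reducible_index E A"
  have A: "A \<notin> reduced_monoms E"
    by (auto simp: A_def reduced_monoms_def lookup_add not_less intro!: exI[of _ i])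
  then have NA: "?N A = - (\<Sum>\<gamma>\<in>?G. c j \<gamma> * ?N (A - Poly_Mapping.single j E + \<gamma>))"
    by (subst normal_form.simps) (simp add: j_def)
  show ?case
  proof (cases "j = i")
    case True
    then have "A - Poly_Mapping.single j E = \<alpha>"
      by (simp add: A_def)
    then show ?thesis
      using NA True by (simp add: A_def)
  next
    case False
    have "E \<le> Poly_Mapping.lookup A j"
      unfolding j_def by (rule reducible_index[OF A])
    then have "E \<le> Poly_Mapping.lookup \<alpha> j"
      using False by (simp add: A_def lookup_add lookup_single when_def)
    then obtain \<alpha>' where \<alpha>': "\<alpha> = \<alpha>' + Poly_Mapping.single j E"
      using monom_split by metis
    have deg: "monom_degree (\<alpha>' + \<gamma>) < monom_degree \<alpha>" if "\<gamma> \<in> ?G" for \<gamma>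
      using that by (simp add: \<alpha>' monom_degree_add monom_degree_single)
    have IH: "?N (\<alpha>' + \<gamma> + Poly_Mapping.single k E) = - (\<Sum>\<gamma>'\<in>?G. c k \<gamma>' * ?N (\<alpha>' + \<gamma> + \<gamma>'))"
      if "\<gamma> \<in> ?G" for \<gamma> k
      using less[OF deg[OF that], of k] by (simp add: eq_neg_iff_add_eq_0)
    have "A = \<alpha>' + Poly_Mapping.single i E + Poly_Mapping.single j E"
      by (simp add: A_def \<alpha>' add_ac)
    then have "A - Poly_Mapping.single j E = \<alpha>' + Poly_Mapping.single i E"
      by simp
    then have "?N A = - (\<Sum>\<gamma>\<in>?G. c j \<gamma> * ?N (\<alpha>' + \<gamma> + Poly_Mapping.single i E))"
      by (simp add: NA add_ac)
    also have "\<dots> = (\<Sum>\<gamma>\<in>?G. \<Sum>\<gamma>'\<in>?G. c j \<gamma> * (c i \<gamma>' * ?N (\<alpha>' + \<gamma> + \<gamma>')))"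
      unfolding sum_negf[symmetric] by (intro sum.cong refl) (simp add: IH sum_distrib_left)
    also have "\<dots> = (\<Sum>\<gamma>'\<in>?G. \<Sum>\<gamma>\<in>?G. c j \<gamma> * (c i \<gamma>' * ?N (\<alpha>' + \<gamma> + \<gamma>')))"
      by (rule sum.swap)
    also have "\<dots> = - (\<Sum>\<gamma>'\<in>?G. c i \<gamma>' * ?N (\<alpha>' + \<gamma>' + Poly_Mapping.single j E))"
      unfolding sum_negf[symmetric]
      by (intro sum.cong refl) (simp add: IH sum_distrib_left, simp add: ac_simps)
    finally show ?thesis
      by (simp add: A_def \<alpha>' add_ac)
  qed
qed

lemma single_mult_monic_system:
  "Poly_Mapping.single \<alpha> d * monic_system E c i = Poly_Mapping.single (\<alpha> + Poly_Mapping.single i E) d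
    + (\<Sum>\<gamma> | monom_degree \<gamma> < E. Poly_Mapping.single (\<alpha> + \<gamma>) (d * c i \<gamma>))"
  by (simp add: monic_system_def distrib_left Var_power mult_single sum_distrib_left)

lemma normal_form_ideal:
  assumes "f \<in> ideal_gen (monic_system E c)"
  shows "mono_ext (normal_form E c \<beta>) f = 0"
proof -
  have mult: "mono_ext (normal_form E c \<beta>) (f * monic_system E c i) = 0" for f i
  proof (induction f rule: cpoly_induct)
    case (single m d)
    have "mono_ext (normal_form E c \<beta>) (Poly_Mapping.single m d * monic_system E c i) =
      d * (normal_form E c \<beta> (m + Poly_Mapping.single i E) +
        (\<Sum>\<gamma> | monom_degree \<gamma> < E. c i \<gamma> * normal_form E c \<beta> (m + \<gamma>)))"
      by (simp add: single_mult_monic_system mono_ext_add mono_ext_sum distrib_left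
          sum_distrib_left mult.assoc)
    then show ?case
      by (simp add: normal_form_relation)
  qed (simp add: distrib_right mono_ext_add)
  show ?thesis
    using assms by (induction rule: poly_ideal.span_induct_alt) (auto simp: mono_ext_add mult)
qed

lemma normal_form_expand:
  fixes f :: "'n::finite cpoly"
  shows "f - (\<Sum>\<beta>\<in>reduced_monoms E. Const (mono_ext (normal_form E c \<beta>) f) * Poly_Mapping.single \<beta> 1)
    \<in> ideal_gen (monic_system E c)"
proof -
  let ?I = "ideal_gen (monic_system E c)" and ?B = "reduced_monoms E :: 'n monom set"
  define R where "R f = f - (\<Sum>\<beta>\<in>?B. Const (mono_ext (normal_form E c \<beta>) f) * Poly_Mapping.single \<beta> 1)" for f
  have R_add: "R (f + g) = R f + R g" for f g
    by (simp add: R_def mono_ext_add Const_add distrib_right sum.distrib)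
  have R_Const: "R (Const d * f) = Const d * R f" for d f
    by (simp add: R_def mono_ext_Const_mult Const_mult right_diff_distrib sum_distrib_left mult.assoc)
  have R_sum: "R (sum u A) = (\<Sum>a\<in>A. R (u a))" for u and A :: "'n monom set"
  proof -
    have "R 0 = 0" by (simp add: R_def)
    then show ?thesis
      by (induction A rule: infinite_finite_induct) (simp_all add: R_add)
  qed
  have R_I: "R f = f" if "f \<in> ?I" for f
    using that by (simp add: R_def normal_form_ideal)
  have monom: "R (Poly_Mapping.single \<alpha> 1) \<in> ?I" for \<alpha>
  proof (induction "monom_degree \<alpha>" arbitrary: \<alpha> rule: less_induct)
    case less
    show ?case
    proof (cases "\<alpha> \<in> ?B")
      case True
      then have "normal_form E c \<beta> \<alpha> = (if \<beta> = \<alpha> then 1 else 0)" for \<beta>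
        by (subst normal_form.simps) auto
      then have "R (Poly_Mapping.single \<alpha> 1) = 0"
        using True finite_reduced_monoms[where ?'n = 'n and E = E]
        by (simp add: R_def if_distrib[of Const] if_distrib[of "\<lambda>x. x * _"] sum.delta cong: if_cong)
      then show ?thesis
        by (simp add: poly_ideal.span_zero)
    next
      case False
      define i where "i = reducible_index E \<alpha>"
      define \<alpha>' where "\<alpha>' = \<alpha> - Poly_Mapping.single i E"
      have \<alpha>: "\<alpha>' + Poly_Mapping.single i E = \<alpha>"
        unfolding \<alpha>'_def i_def by (rule monom_split[OF reducible_index[OF False]])
      define s where "s = Poly_Mapping.single \<alpha>' 1 * monic_system E c i"
      have s: "s \<in> ?I"
        unfolding s_def by (intro poly_ideal.span_scale in_ideal_gen)
      have s_eq: "s = Poly_Mapping.single \<alpha> 1 + (\<Sum>\<gamma> | monom_degree \<gamma> < E. Const (c i \<gamma>) * Poly_Mapping.single (\<alpha>' + \<gamma>) 1)"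
        unfolding s_def single_mult_monic_system \<alpha> by (simp add: Const_times_single)
      have "R s = R (Poly_Mapping.single \<alpha> 1) +
          (\<Sum>\<gamma> | monom_degree \<gamma> < E. Const (c i \<gamma>) * R (Poly_Mapping.single (\<alpha>' + \<gamma>) 1))"
        by (simp only: s_eq R_add R_sum R_Const)
      then have eq: "R (Poly_Mapping.single \<alpha> 1) =
          s - (\<Sum>\<gamma> | monom_degree \<gamma> < E. Const (c i \<gamma>) * R (Poly_Mapping.single (\<alpha>' + \<gamma>) 1))"
        using R_I[OF s] by (simp add: eq_diff_eq)
      have "R (Poly_Mapping.single (\<alpha>' + \<gamma>) 1) \<in> ?I" if "monom_degree \<gamma> < E" for \<gamma>
        using monom_degree_reduce[OF False that] unfolding \<alpha>'_def i_def by (rule less)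
      then have "(\<Sum>\<gamma> | monom_degree \<gamma> < E. Const (c i \<gamma>) * R (Poly_Mapping.single (\<alpha>' + \<gamma>) 1)) \<in> ?I"
        by (intro poly_ideal.span_sum poly_ideal.span_scale) simp
      then show ?thesis
        unfolding eq by (rule poly_ideal.span_diff[OF s])
    qed
  qed
  have "R f \<in> ?I"
  proof (induction f rule: cpoly_induct)
    case (single m d)
    have "R (Const d * Poly_Mapping.single m 1) \<in> ?I"
      unfolding R_Const by (intro poly_ideal.span_scale monom)
    then show ?case by (simp add: Const_times_single)
  next
    case (add f g)
    then show ?case unfolding R_add by (rule poly_ideal.span_add)
  qed
  then show ?thesis by (simp add: R_def)
qed

lemma dual_system_monic:
  "dual_system (ideal_gen (monic_system E c)) (reduced_monoms E) (\<lambda>\<beta>. Poly_Mapping.single \<beta> 1)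
    (\<lambda>\<beta>. mono_ext (normal_form E c \<beta>))"
  unfolding dual_system_def
  using normal_form_expand normal_form_ideal by (auto simp: mono_ext_add mono_ext_Const_mult)

lemma comp_series_monic:
  fixes c :: "'n::finite \<Rightarrow> 'n monom \<Rightarrow> complex"
  shows "\<exists>Q. comp_series (ideal_gen (monic_system E c)) Q"
proof -
  let ?I = "ideal_gen (monic_system E c)"
  let ?e = "\<lambda>\<beta> :: 'n monom. Poly_Mapping.single \<beta> (1 :: complex)"
  have "finite (?e ` reduced_monoms E)"
    by (intro finite_imageI finite_reduced_monoms)
  then obtain es where es: "set es = ?e ` reduced_monoms E"
    using finite_list by blast
  have "f \<in> cvec.span (?I \<union> set es)" for f
  proof -
    let ?s = "\<Sum>\<beta>\<in>reduced_monoms E. Const (mono_ext (normal_form E c \<beta>) f) * Poly_Mapping.single \<beta> 1"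
    have "f - ?s \<in> cvec.span (?I \<union> set es)"
      using normal_form_expand by (intro cvec.span_base) blast
    moreover have "?s \<in> cvec.span (?I \<union> set es)"
      by (intro cvec.span_sum cvec.span_scale cvec.span_base) (simp add: es)
    ultimately show ?thesis
      using cvec.span_add[of "f - ?s" _ ?s] by simp
  qed
  then have "cvec.span (?I \<union> set es) = UNIV"
    by blast
  then show ?thesis
    using comp_series_exists[OF poly_ideal.subspace_span] indep_mod_length_le by blast
qed

lemma length_comp_series_monic:
  fixes c :: "'n::finite \<Rightarrow> 'n monom \<Rightarrow> complex"
  assumes "comp_series (ideal_gen (monic_system E c)) Q"
  shows "length Q = card (reduced_monoms E :: 'n monom set)"
proof -
  have "normal_form E c \<beta> \<beta> = 1" if "\<beta> \<in> reduced_monoms E" for \<beta>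
    using that by (subst normal_form.simps) simp
  then have "of_nat (card (reduced_monoms E :: 'n monom set)) =
      (\<Sum>\<beta>\<in>reduced_monoms E. mono_ext (normal_form E c \<beta>) (1 * Poly_Mapping.single \<beta> 1))"
    by simp
  also have "\<dots> = sum_list (map (eval_poly 1) Q)"
    by (rule trace_comp_series[OF assms dual_system_monic])
  also have "\<dots> = of_nat (length Q)"
    by (induction Q) auto
  finally show ?thesis
    using of_nat_eq_iff by metis
qed

lemma continuous_normal_form:
  assumes "\<And>i \<gamma>. continuous_on S (\<lambda>s. c s i \<gamma>)"
  shows "continuous_on S (\<lambda>s. normal_form E (c s) \<beta> \<alpha>)"
proof (induction "monom_degree \<alpha>" arbitrary: \<alpha> rule: less_induct)
  case less
  show ?case
  proof (cases "\<alpha> \<in> reduced_monoms E")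
    case True
    then show ?thesis by (subst normal_form.simps) simp
  next
    case False
    then show ?thesis
      by (subst normal_form.simps)
        (simp, intro continuous_intros assms less monom_degree_reduce, auto)
  qed
qed

lemma continuous_trace:
  assumes "\<And>i \<gamma>. continuous_on S (\<lambda>s. c s i \<gamma>)"
    and "\<And>s. s \<in> S \<Longrightarrow> comp_series (ideal_gen (monic_system E (c s))) (Q s)"
  shows "continuous_on S (\<lambda>s. sum_list (map (eval_poly f) (Q s)))"
proof -
  have "continuous_on S (\<lambda>s. \<Sum>\<beta>\<in>reduced_monoms E.
      mono_ext (normal_form E (c s) \<beta>) (f * Poly_Mapping.single \<beta> 1))"
    unfolding mono_ext_def by (intro continuous_intros continuous_normal_form assms(1))
  then show ?thesis
    by (rule continuous_on_eq) (rule trace_comp_series[OF assms(2) dual_system_monic])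
qed

section \<open>Invariance of the number of zeros along a path\<close>

definition degree_lt :: "nat \<Rightarrow> 'n::finite cpoly \<Rightarrow> bool" where
  "degree_lt E f \<longleftrightarrow> (\<forall>m\<in>Poly_Mapping.keys f. monom_degree m < E)"

lemma degree_lt_add: "degree_lt E f \<Longrightarrow> degree_lt E g \<Longrightarrow> degree_lt E (f + g)"
  using keys_add[of f g] by (auto simp: degree_lt_def)

lemma degree_lt_Const_mult: "degree_lt E f \<Longrightarrow> degree_lt E (Const c * f)"
  using keys_mult[of "Const c" f]
  by (auto simp: degree_lt_def Const_def split: if_splits)

lemma degree_lt_mult:
  assumes "degree_lt a f" "degree_lt (Suc b) g"
  shows "degree_lt (a + b) (f * g)"
  using keys_mult[of f g] assms unfolding degree_lt_def
  by (force simp: monom_degree_add)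

lemma degree_lt_mono: "degree_lt a f \<Longrightarrow> a \<le> b \<Longrightarrow> degree_lt b f"
  by (auto simp: degree_lt_def)

lemma degree_lt_Var_power: "degree_lt (Suc k) (Var i ^ k)"
  by (auto simp: degree_lt_def Var_power monom_degree_single split: if_splits)

lemma degree_lt_monic_mult:
  assumes "degree_lt a (f - Var i ^ a)" "degree_lt b (g - Var i ^ b)"
  shows "degree_lt (a + b) (f * g - Var i ^ (a + b))"
proof -
  have "f * g - Var i ^ (a + b) = (f - Var i ^ a) * (g - Var i ^ b) + (f - Var i ^ a) * Var i ^ b
      + (g - Var i ^ b) * Var i ^ a"
    by (simp add: power_add algebra_simps)
  moreover have "degree_lt (b + a) ((g - Var i ^ b) * Var i ^ a)"
    by (intro degree_lt_mult assms degree_lt_Var_power)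
  ultimately show ?thesis
    using degree_lt_mult[OF assms(1) degree_lt_Var_power[of b i]]
      degree_lt_mult[OF assms(1) degree_lt_mono[OF assms(2), of "Suc b"]]
    by (auto simp: add.commute intro!: degree_lt_add)
qed

lemma degree_lt_prod_powers:
  assumes "finite W"
  shows "degree_lt (K * card W) ((\<Prod>w\<in>W. (Var i - Const (w i)) ^ K) - Var i ^ (K * card W))"
  using assms
proof (induction W rule: finite_induct)
  case empty
  show ?case by (simp add: degree_lt_def)
next
  case (insert w W)
  have "degree_lt k ((Var i - Const (w i)) ^ k - Var i ^ k)" for k
  proof (induction k)
    case (Suc k)
    have "degree_lt 1 ((Var i - Const (w i)) - Var i ^ 1)"
      by (auto simp: degree_lt_def monom_degree_def Const_def simp flip: single_uminus split: if_splits)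
    from degree_lt_monic_mult[OF this Suc] show ?case by simp
  qed (simp add: degree_lt_def)
  from degree_lt_monic_mult[OF this[of K] insert.IH] show ?case
    using insert.hyps by simp
qed

lemma monic_system_lookup:
  assumes "degree_lt E (f i - Var i ^ E)"
  shows "monic_system E (\<lambda>i. Poly_Mapping.lookup (f i - Var i ^ E)) i = f i"
proof -
  have "(\<Sum>m | monom_degree m < E. Poly_Mapping.single m (Poly_Mapping.lookup (f i - Var i ^ E) m)) =
      f i - Var i ^ E"
    using assms by (intro poly_mapping_eqI)
      (auto simp: lookup_sum lookup_single when_def sum.delta' finite_monoms_degree_less degree_lt_def in_keys_iff)
  then show ?thesis by (simp add: monic_system_def)
qed

lemma eval_poly_degree_lt_bound:
  fixes f :: "'n::finite cpoly"
  assumes "degree_lt (Suc k) f" "1 \<le> M" "\<And>i. cmod (x i) \<le> M"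
  shows "cmod (eval_poly f x) \<le> (\<Sum>m\<in>Poly_Mapping.keys f. cmod (Poly_Mapping.lookup f m)) * M ^ k"
proof -
  have "cmod (\<Prod>i\<in>UNIV. x i ^ Poly_Mapping.lookup m i) \<le> M ^ k" if "m \<in> Poly_Mapping.keys f" for m
  proof -
    have "cmod (\<Prod>i\<in>UNIV. x i ^ Poly_Mapping.lookup m i) \<le> (\<Prod>i\<in>UNIV. M ^ Poly_Mapping.lookup m i)"
      using assms(3) by (auto simp: prod_norm[symmetric] norm_power intro!: prod_mono power_mono)
    also have "\<dots> = M ^ monom_degree m"
      by (simp add: monom_degree_def power_sum)
    also have "\<dots> \<le> M ^ k"
      using assms(1,2) that by (intro power_increasing) (auto simp: degree_lt_def)
    finally show ?thesis .
  qed
  then have "cmod (Poly_Mapping.lookup f m * (\<Prod>i\<in>UNIV. x i ^ Poly_Mapping.lookup m i))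
      \<le> cmod (Poly_Mapping.lookup f m) * M ^ k" if "m \<in> Poly_Mapping.keys f" for m
    using that by (simp add: norm_mult mult_left_mono)
  then show ?thesis
    unfolding eval_poly_def sum_distrib_right by (rule sum_norm_le)
qed

lemma compact_closed_polydisc:
  fixes p :: "'n \<Rightarrow> complex"
  shows "compact {x. \<forall>i. cmod (p i - x i) \<le> e}"
proof -
  have "compactin (product_topology (\<lambda>i. euclidean) UNIV) (PiE UNIV (\<lambda>i. cball (p i) e))"
    unfolding compactin_PiE by simp
  moreover have "PiE UNIV (\<lambda>i. cball (p i) e) = {x. \<forall>i. cmod (p i - x i) \<le> e}"
    by (auto simp: PiE_def Pi_def dist_norm)
  ultimately show ?thesis
    by (simp add: euclidean_product_topology)
qed

lemma nonzero_on_compact_bound: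
  fixes f :: "'n::finite \<Rightarrow> 'n cpoly"
  assumes "compact C" "C \<inter> common_zeros f = {}"
  shows "\<exists>e>0. \<forall>x\<in>C. e \<le> (\<Sum>i\<in>UNIV. cmod (eval_poly (f i) x))"
proof (cases "C = {}")
  case True
  then show ?thesis by (intro exI[of _ 1]) simp
next
  case False
  have "continuous_on C (\<lambda>x. \<Sum>i\<in>UNIV. cmod (eval_poly (f i) x))"
    by (intro continuous_intros)
  from continuous_attains_inf[OF assms(1) False this]
  obtain y where y: "y \<in> C"
    "\<forall>x\<in>C. (\<Sum>i\<in>UNIV. cmod (eval_poly (f i) y)) \<le> (\<Sum>i\<in>UNIV. cmod (eval_poly (f i) x))"
    by blast
  have "(\<Sum>i\<in>UNIV. cmod (eval_poly (f i) y)) \<noteq> 0"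
    using y(1) assms(2) by (subst sum_nonneg_eq_0_iff) (auto simp: common_zeros_def)
  then have "0 < (\<Sum>i\<in>UNIV. cmod (eval_poly (f i) y))"
    by (simp add: less_le sum_nonneg)
  then show ?thesis using y by blast
qed

lemma bounded_on_compact:
  fixes f :: "'n::finite \<Rightarrow> 'n cpoly"
  assumes "compact C"
  shows "\<exists>M>0. \<forall>x\<in>C. (\<Sum>i\<in>UNIV. cmod (eval_poly (f i) x)) < M"
proof (cases "C = {}")
  case True
  then show ?thesis by (intro exI[of _ 1]) simp
next
  case False
  have "continuous_on C (\<lambda>x. \<Sum>i\<in>UNIV. cmod (eval_poly (f i) x))"
    by (intro continuous_intros)
  from continuous_attains_sup[OF assms(1) False this]
  obtain y where "\<forall>x\<in>C. (\<Sum>i\<in>UNIV. cmod (eval_poly (f i) x)) \<le> (\<Sum>i\<in>UNIV. cmod (eval_poly (f i) y))"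
    by blast
  then show ?thesis
    by (intro exI[of _ "(\<Sum>i\<in>UNIV. cmod (eval_poly (f i) y)) + 1"])
      (auto simp: sum_nonneg add_nonneg_pos intro: le_less_trans)
qed

lemma interpolation:
  fixes Z A :: "('n::finite \<Rightarrow> complex) set"
  assumes "finite Z"
  shows "\<exists>f. \<forall>z\<in>Z. eval_poly f z = (if z \<in> A then 1 else 0)"
proof -
  have "\<exists>f. eval_poly f a = 1 \<and> (\<forall>b\<in>Z - {a}. eval_poly f b = 0)" for a
  proof -
    have "\<exists>f. eval_poly f a = 1 \<and> eval_poly f b = 0" if "b \<noteq> a" for b
    proof -
      obtain i where "b i \<noteq> a i" using \<open>b \<noteq> a\<close> by (metis ext)
      then show ?thesis
        by (intro exI[of _ "Const (1 / (a i - b i)) * (Var i - Const (b i))"]) auto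
    qed
    then obtain F where F: "\<And>b. b \<noteq> a \<Longrightarrow> eval_poly (F b) a = 1 \<and> eval_poly (F b) b = 0"
      by metis
    have "eval_poly (\<Prod>b\<in>Z - {a}. F b) a = 1"
      using F by simp
    moreover have "eval_poly (\<Prod>b\<in>Z - {a}. F b) c = 0" if "c \<in> Z - {a}" for c
      using F that assms by (auto intro!: prod_zero)
    ultimately show ?thesis by blast
  qed
  then obtain L where L: "\<And>a. eval_poly (L a) a = 1" "\<And>a b. b \<in> Z \<Longrightarrow> b \<noteq> a \<Longrightarrow> eval_poly (L a) b = 0"
    by (metis DiffI singletonD)
  have "eval_poly (\<Sum>a\<in>Z \<inter> A. L a) z = (if z \<in> A then 1 else 0)" if "z \<in> Z" for z
  proof -
    have "eval_poly (\<Sum>a\<in>Z \<inter> A. L a) z = (\<Sum>a\<in>Z \<inter> A. if z = a then 1 else 0)"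
      using L that by (auto intro!: sum.cong)
    then show ?thesis
      using assms that by (simp add: sum.delta)
  qed
  then show ?thesis by blast
qed

lemma lookup_Const_mult: "Poly_Mapping.lookup (Const c * f) m = c * Poly_Mapping.lookup f m"
  by (induction f rule: cpoly_induct) (simp_all add: Const_times_single lookup_single lookup_add distrib_left when_def)

lemma sum_list_near:
  assumes "\<And>q. q \<in> set Q \<Longrightarrow> cmod (F q - (if P q then 1 else 0)) \<le> \<eta>"
  shows "cmod (sum_list (map F Q) - of_nat (length (filter P Q))) \<le> \<eta> * length Q"
  using assms
proof (induction Q)
  case (Cons q Q)
  have "sum_list (map F (q # Q)) - of_nat (length (filter P (q # Q))) =
      (F q - (if P q then 1 else 0)) + (sum_list (map F Q) - of_nat (length (filter P Q)))"
    by simp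
  also have "cmod \<dots> \<le> \<eta> + \<eta> * length Q"
    by (rule norm_triangle_mono) (use Cons in auto)
  finally show ?case by (simp add: algebra_simps)
qed simp

context
  fixes f0 f1 :: "'n::finite \<Rightarrow> 'n cpoly" and E :: nat
  assumes E: "0 < E"
    and f0: "\<And>i. degree_lt E (f0 i - Var i ^ E)" and f1: "\<And>i. degree_lt E (f1 i - Var i ^ E)"
begin

definition segment :: "real \<Rightarrow> 'n \<Rightarrow> 'n cpoly" where
  "segment s i = f0 i + Const (of_real s) * (f1 i - f0 i)"

lemma segment_ends: "segment 0 = f0" "segment 1 = f1"
  by (auto simp: segment_def)

lemma segment_monic: "degree_lt E (segment s i - Var i ^ E)"
proof -
  have "segment s i - Var i ^ E = Const (of_real (1 - s)) * (f0 i - Var i ^ E) + Const (of_real s) * (f1 i - Var i ^ E)"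
    by (simp add: segment_def Const_diff algebra_simps)
  then show ?thesis
    by (simp add: degree_lt_add degree_lt_Const_mult f0 f1)
qed

definition segment_coeff :: "real \<Rightarrow> 'n \<Rightarrow> 'n monom \<Rightarrow> complex" where
  "segment_coeff s i = Poly_Mapping.lookup (segment s i - Var i ^ E)"

lemma monic_system_segment: "monic_system E (segment_coeff s) = segment s"
  unfolding segment_coeff_def[abs_def] using monic_system_lookup segment_monic by blast

lemma continuous_segment_coeff: "continuous_on S (\<lambda>s. segment_coeff s i m)"
  unfolding segment_coeff_def segment_def lookup_minus lookup_add lookup_Const_mult
  by (intro continuous_intros)

lemma zeros_segment_bounded:
  "\<exists>R. \<forall>s\<in>{0..1}. \<forall>x\<in>common_zeros (segment s). \<forall>i. cmod (x i) \<le> R"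
proof -
  define c where "c f = (\<Sum>m\<in>Poly_Mapping.keys f. cmod (Poly_Mapping.lookup f m))" for f :: "'n cpoly"
  define L where "L = (\<Sum>i\<in>UNIV. c (f0 i - Var i ^ E) + c (f1 i - Var i ^ E))"
  have c0: "0 \<le> c f" for f unfolding c_def by (rule sum_nonneg) simp
  obtain k where k: "E = Suc k" using E by (cases E) auto
  have "cmod (x i) \<le> max 1 L" if s: "s \<in> {0..1}" and x: "x \<in> common_zeros (segment s)" for s x i
  proof -
    define M where "M = Max (range (\<lambda>i. cmod (x i)))"
    have M: "cmod (x i) \<le> M" for i
      unfolding M_def by (intro Max_ge) auto
    have "M \<in> range (\<lambda>i. cmod (x i))"
      unfolding M_def by (intro Max_in) auto
    then obtain j where j: "M = cmod (x j)" by blast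
    have "M \<le> L" if "1 < M"
    proof -
      have bound: "cmod (eval_poly (f j - Var j ^ E) x) \<le> c (f j - Var j ^ E) * M ^ k"
        if "degree_lt E (f j - Var j ^ E)" for f
        unfolding c_def using that M \<open>1 < M\<close> by (intro eval_poly_degree_lt_bound) (auto simp: k)
      have "eval_poly (segment s j) x = 0"
        using x by (simp add: common_zeros_def)
      then have "x j ^ E = - (of_real (1 - s) * eval_poly (f0 j - Var j ^ E) x
          + of_real s * eval_poly (f1 j - Var j ^ E) x)"
        by (simp add: segment_def algebra_simps eq_neg_iff_add_eq_0)
      then have "M ^ E \<le> (1 - s) * cmod (eval_poly (f0 j - Var j ^ E) x) + s * cmod (eval_poly (f1 j - Var j ^ E) x)"
        unfolding j norm_power[symmetric] norm_minus_cancel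
        using s by (metis (no_types, lifting) abs_of_nonneg atLeastAtMost_iff diff_ge_0_iff_ge norm_minus_cancel
            norm_mult norm_of_real norm_triangle_ineq)
      also have "\<dots> \<le> 1 * (c (f0 j - Var j ^ E) * M ^ k) + 1 * (c (f1 j - Var j ^ E) * M ^ k)"
        using s by (intro add_mono mult_mono bound f0 f1) auto
      also have "\<dots> \<le> L * M ^ k"
        unfolding mult_1 distrib_right[symmetric] L_def
        using that c0 by (intro mult_right_mono member_le_sum) auto
      finally show "M \<le> L"
        using that by (simp add: k)
    qed
    then show ?thesis
      using M[of i] by fastforce
  qed
  then show ?thesis by blast
qed

lemma segment_zeros_near:
  assumes s0: "s0 \<in> {0..1}" and N: "open N" "common_zeros (segment s0) \<subseteq> N"
  shows "\<exists>d>0. \<forall>s\<in>{0..1}. \<bar>s - s0\<bar> < d \<longrightarrow> common_zeros (segment s) \<subseteq> N"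
proof -
  obtain R where R: "\<And>s x i. s \<in> {0..1} \<Longrightarrow> x \<in> common_zeros (segment s) \<Longrightarrow> cmod (x i) \<le> R"
    using zeros_segment_bounded by blast
  define C where "C = {x :: 'n \<Rightarrow> complex. \<forall>i. cmod (0 - x i) \<le> R} - N"
  have C: "compact C"
    unfolding C_def by (intro compact_diff N compact_closed_polydisc)
  have "C \<inter> common_zeros (segment s0) = {}"
    using N(2) by (auto simp: C_def)
  then obtain e where e: "0 < e" "\<And>x. x \<in> C \<Longrightarrow> e \<le> (\<Sum>i\<in>UNIV. cmod (eval_poly (segment s0 i) x))"
    using nonzero_on_compact_bound[OF C] by blast
  obtain M where M: "0 < M" "\<And>x. x \<in> C \<Longrightarrow> (\<Sum>i\<in>UNIV. cmod (eval_poly (f1 i - f0 i) x)) < M"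
    using bounded_on_compact[OF C, of "\<lambda>i. f1 i - f0 i"] by blast
  have "x \<in> N" if s: "s \<in> {0..1}" "\<bar>s - s0\<bar> < e / M" and x: "x \<in> common_zeros (segment s)" for s x
  proof (rule ccontr)
    assume "x \<notin> N"
    then have "x \<in> C" using R[OF s(1) x] by (simp add: C_def)
    have "eval_poly (segment s0 i) x = of_real (s0 - s) * eval_poly (f1 i - f0 i) x" for i
    proof -
      have "eval_poly (segment s i) x = 0"
        using x by (simp add: common_zeros_def)
      then show ?thesis by (simp add: segment_def algebra_simps)
    qed
    then have "(\<Sum>i\<in>UNIV. cmod (eval_poly (segment s0 i) x)) = \<bar>s0 - s\<bar> * (\<Sum>i\<in>UNIV. cmod (eval_poly (f1 i - f0 i) x))"
      by (simp only: norm_mult norm_of_real sum_distrib_left)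
    also have "\<dots> \<le> \<bar>s0 - s\<bar> * M"
      using M(2)[OF \<open>x \<in> C\<close>] by (intro mult_left_mono) auto
    also have "\<dots> < e"
      using s(2) M(1) by (simp add: pos_less_divide_eq abs_minus_commute)
    finally show False
      using e(2)[OF \<open>x \<in> C\<close>] by simp
  qed
  then show ?thesis
    using e M by (intro exI[of _ "e / M"]) auto
qed

text \<open>
  The number of zeros in \<open>U\<close> is approximately the sum, over all zeros, of the values of a polynomial
  that is close to 1 at the zeros in \<open>U\<close> and close to 0 at the zeros in \<open>V\<close>; this sum is
  the trace of a multiplication operator and depends continuously on the system.
\<close>

lemma segment_count_eq:
  assumes U: "open U" and V: "open V" and UV: "U \<inter> V = {}"
    and zeros: "\<And>s. s \<in> {0..1} \<Longrightarrow> common_zeros (segment s) \<subseteq> U \<union> V"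
    and Q0: "comp_series (ideal_gen f0) Q0" and Q1: "comp_series (ideal_gen f1) Q1"
  shows "length (filter (\<lambda>q. q \<in> U) Q0) = length (filter (\<lambda>q. q \<in> U) Q1)"
proof -
  define Q where "Q s = (SOME Q. comp_series (ideal_gen (segment s)) Q \<and> (s = 0 \<longrightarrow> Q = Q0) \<and> (s = 1 \<longrightarrow> Q = Q1))" for s
  have "\<exists>Q. comp_series (ideal_gen (segment s)) Q \<and> (s = 0 \<longrightarrow> Q = Q0) \<and> (s = 1 \<longrightarrow> Q = Q1)" for s
    using comp_series_monic[of E "segment_coeff s"] Q0 Q1
    by (cases "s = 0"; cases "s = 1") (auto simp: monic_system_segment segment_ends)
  from someI_ex[OF this] have Q: "comp_series (ideal_gen (segment s)) (Q s)" and "Q 0 = Q0" "Q 1 = Q1" for s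
    unfolding Q_def[symmetric] by auto
  define m where "m s = length (filter (\<lambda>q. q \<in> U) (Q s))" for s
  define D where "D = card (reduced_monoms E :: 'n monom set)"
  have D: "length (Q s) = D" for s
    unfolding D_def using length_comp_series_monic[of E "segment_coeff s"] Q[of s] monic_system_segment by simp
  have setQ: "set (Q s) = common_zeros (segment s)" for s
    by (rule comp_series_set[OF Q])
  have "\<forall>s0\<in>{0..1}. eventually (\<lambda>s. m s0 = m s) (at s0 within {0..1})"
  proof
    fix s0 :: real assume s0: "s0 \<in> {0..1}"
    obtain F where F: "\<And>z. z \<in> common_zeros (segment s0) \<Longrightarrow> eval_poly F z = (if z \<in> U then 1 else 0)"
      using interpolation[of "common_zeros (segment s0)" U] setQ[of s0] by (metis List.finite_set)
    define \<eta> where "\<eta> = 1 / (2 * (real D + 1))"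
    have \<eta>: "0 < \<eta>" "\<eta> * D < 1 / 2" by (auto simp: \<eta>_def field_simps)
    define N where "N = (U \<inter> {x. cmod (eval_poly F x - 1) < \<eta>}) \<union> (V \<inter> {x. cmod (eval_poly F x) < \<eta>})"
    have "open N"
      unfolding N_def by (intro open_Un open_Int U V open_Collect_less continuous_intros)
    moreover have "common_zeros (segment s0) \<subseteq> N"
    proof
      fix x assume x: "x \<in> common_zeros (segment s0)"
      moreover have "x \<in> U \<or> x \<in> V" "x \<in> V \<Longrightarrow> x \<notin> U"
        using zeros[OF s0] x UV by blast+
      ultimately show "x \<in> N"
        using F[OF x] \<eta>(1) by (auto simp: N_def)
    qed
    ultimately obtain d where d: "d > 0" "\<And>s. s \<in> {0..1} \<Longrightarrow> \<bar>s - s0\<bar> < d \<Longrightarrow> common_zeros (segment s) \<subseteq> N"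
      using segment_zeros_near[OF s0, of N] by metis
    have near: "cmod (sum_list (map (eval_poly F) (Q s)) - of_nat (m s)) < 1 / 2"
      if "s \<in> {0..1}" "\<bar>s - s0\<bar> < d" for s
    proof -
      have "cmod (eval_poly F q - (if q \<in> U then 1 else 0)) \<le> \<eta>" if "q \<in> set (Q s)" for q
      proof -
        have "q \<in> N"
          using d(2)[OF \<open>s \<in> {0..1}\<close> \<open>\<bar>s - s0\<bar> < d\<close>] that setQ by blast
        moreover have "q \<in> V \<Longrightarrow> q \<notin> U"
          using UV by blast
        ultimately show ?thesis
          unfolding N_def by (auto intro: less_imp_le)
      qed
      then have "cmod (sum_list (map (eval_poly F) (Q s)) - of_nat (m s)) \<le> \<eta> * length (Q s)"
        unfolding m_def by (rule sum_list_near)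
      then show ?thesis using \<eta>(2) D by simp
    qed
    have tr0: "sum_list (map (eval_poly F) (Q s0)) = of_nat (m s0)"
    proof -
      have "cmod (sum_list (map (eval_poly F) (Q s0)) - of_nat (m s0)) \<le> (0 :: real) * length (Q s0)"
        unfolding m_def by (rule sum_list_near) (simp add: setQ F)
      then show ?thesis by simp
    qed
    have "continuous_on {0..1} (\<lambda>s. sum_list (map (eval_poly F) (Q s)))"
      by (rule continuous_trace[where E = E and c = segment_coeff])
        (use Q in \<open>simp_all add: monic_system_segment continuous_segment_coeff\<close>)
    then obtain d' where d': "d' > 0" "\<And>s. s \<in> {0..1} \<Longrightarrow> \<bar>s - s0\<bar> < d' \<Longrightarrow>
        cmod (sum_list (map (eval_poly F) (Q s)) - sum_list (map (eval_poly F) (Q s0))) < 1 / 2"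
      using s0 unfolding continuous_on_iff dist_norm real_norm_def
      by (metis half_gt_zero_iff zero_less_one)
    have "m s0 = m s" if s: "s \<in> {0..1}" "\<bar>s - s0\<bar> < min d d'" for s
    proof -
      let ?S = "sum_list (map (eval_poly F) (Q s))"
      have "complex_of_nat (m s) - of_nat (m s0) = (?S - of_nat (m s0)) - (?S - of_nat (m s))"
        by simp
      then have "cmod (of_nat (m s) - of_nat (m s0)) \<le> cmod (?S - of_nat (m s0)) + cmod (?S - of_nat (m s))"
        by (metis norm_triangle_ineq4)
      moreover have "cmod (?S - of_nat (m s)) < 1 / 2" "cmod (?S - of_nat (m s0)) < 1 / 2"
        using near[of s] d'(2)[of s] s by (auto simp: tr0)
      ultimately have "cmod (of_nat (m s) - of_nat (m s0)) < 1"
        by linarith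
      then have "\<bar>real (m s) - real (m s0)\<bar> < 1"
        by (metis norm_of_real of_real_diff of_real_of_nat_eq)
      then show ?thesis by linarith
    qed
    then show "eventually (\<lambda>s. m s0 = m s) (at s0 within {0..1})"
      unfolding eventually_at using d d' by (intro exI[of _ "min d d'"]) (auto simp: dist_norm)
  qed
  then have "m 0 = m 1"
    by (intro connected_local_const[of "{0..1 :: real}"]) auto
  then show ?thesis
    by (simp add: m_def \<open>Q 0 = Q0\<close> \<open>Q 1 = Q1\<close>)
qed

end

section \<open>Conservation of multiplicity\<close>

lemma ideal_gen_scale:
  assumes "c \<noteq> 0"
  shows "ideal_gen (\<lambda>i. Const c * h i) = ideal_gen h"
proof (intro equalityI ideal_gen_minimal poly_ideal.subspace_span)
  show "Const c * h i \<in> ideal_gen h" for i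
    by (intro poly_ideal.span_scale in_ideal_gen)
  show "h i \<in> ideal_gen (\<lambda>i. Const c * h i)" for i
    using ideal_Const_cancel[OF poly_ideal.subspace_span assms] in_ideal_gen[of "\<lambda>i. Const c * h i"] by blast
qed

lemma comp_series_of_monic:
  fixes f :: "'n::finite \<Rightarrow> 'n cpoly"
  assumes "\<And>i. degree_lt E (f i - Var i ^ E)"
  shows "\<exists>Q. comp_series (ideal_gen f) Q"
proof -
  have "monic_system E (\<lambda>i. Poly_Mapping.lookup (f i - Var i ^ E)) = f"
    by (intro ext monic_system_lookup assms)
  then show ?thesis
    using comp_series_monic[of E "\<lambda>i. Poly_Mapping.lookup (f i - Var i ^ E)"] by simp
qed

lemma perturbed_count_eq:
  fixes g g' F :: "'n::finite \<Rightarrow> 'n cpoly" and t :: real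
  assumes E: "0 < E" and F: "\<And>i. degree_lt E (F i - Var i ^ E)"
    and g: "\<And>i. degree_lt E (g i)" and g': "\<And>i. degree_lt E (g' i)" and t: "0 < t"
    and UV: "open U" "open V" "U \<inter> V = {}"
    and zeros: "\<And>s :: real. s \<in> {0..1} \<Longrightarrow>
      common_zeros (\<lambda>i. g i + Const (of_real s) * (g' i - g i) + Const (of_real t) * F i) \<subseteq> U \<union> V"
  shows "\<exists>Q Q'. comp_series (ideal_gen (\<lambda>i. g i + Const (of_real t) * F i)) Q \<and>
    comp_series (ideal_gen (\<lambda>i. g' i + Const (of_real t) * F i)) Q' \<and>
    length (filter (\<lambda>q. q \<in> U) Q) = length (filter (\<lambda>q. q \<in> U) Q')"
proof -
  let ?c = "Const (inverse (of_real t)) :: 'n cpoly"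
  have ct: "?c * Const (of_real t) = 1"
    using t by (simp add: Const_inverse_mult)
  define f where "f g i = ?c * (g i + Const (of_real t) * F i)" for g :: "'n \<Rightarrow> 'n cpoly" and i
  have f: "f g i = F i + ?c * g i" for g i
    using ct by (simp add: f_def distrib_left add.commute flip: mult.assoc)
  have monic: "degree_lt E (f g i - Var i ^ E)" if "degree_lt E (g i)" for g i
  proof -
    have "f g i - Var i ^ E = (F i - Var i ^ E) + ?c * g i"
      by (simp add: f)
    then show ?thesis
      by (simp only: degree_lt_add F degree_lt_Const_mult that)
  qed
  have ideal: "ideal_gen (f g) = ideal_gen (\<lambda>i. g i + Const (of_real t) * F i)" for g
    unfolding f_def[abs_def] using t by (intro ideal_gen_scale) simp
  note m = E monic[of g, OF g] monic[of g', OF g']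
  have "common_zeros (segment (f g) (f g') s) \<subseteq> U \<union> V" if "s \<in> {0..1}" for s
  proof -
    have "segment (f g) (f g') s i = ?c * (g i + Const (of_real s) * (g' i - g i) + Const (of_real t) * F i)" for i
      unfolding segment_def[OF m] f_def by (simp add: algebra_simps)
    then have "common_zeros (segment (f g) (f g') s) =
        common_zeros (\<lambda>i. g i + Const (of_real s) * (g' i - g i) + Const (of_real t) * F i)"
      using t by (simp add: common_zeros_def)
    then show ?thesis using zeros[OF that] by simp
  qed
  moreover obtain Q where Q: "comp_series (ideal_gen (f g)) Q"
    using comp_series_of_monic[of E "f g", OF monic[of g, OF g]] by blast
  moreover obtain Q' where Q': "comp_series (ideal_gen (f g')) Q'"
    using comp_series_of_monic[of E "f g'", OF monic[of g', OF g']] by blast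
  ultimately show ?thesis
    using segment_count_eq[OF m UV] unfolding ideal by blast
qed

lemma perturbed_zeros_eq:
  fixes g F :: "'n::finite \<Rightarrow> 'n cpoly"
  assumes C: "compact C" and fin: "finite Z" and Z: "common_zeros g \<inter> C = Z"
    and F: "\<And>q i. q \<in> Z \<Longrightarrow> (Var i - Const (q i)) ^ Suc k dvd F i"
    and pow: "\<And>q i. q \<in> Z \<Longrightarrow> (Var i - Const (q i)) ^ k \<in> loc_ideal q (ideal_gen g)"
  shows "\<exists>t0>0. \<forall>t :: real. 0 < t \<and> t \<le> t0 \<longrightarrow> common_zeros (\<lambda>i. g i + Const (of_real t) * F i) \<inter> C = Z"
proof -
  have "\<exists>U. open U \<and> q \<in> U \<and> (\<forall>t x. cmod t \<le> 1 \<longrightarrow> x \<in> U \<longrightarrow>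
      x \<in> common_zeros (\<lambda>i. g i + Const t * F i) \<longrightarrow> x \<in> common_zeros g)" if q: "q \<in> Z" for q
  proof -
    obtain R where "\<And>i. F i = (Var i - Const (q i)) ^ Suc k * R i"
      using F[OF q] unfolding dvd_def by metis
    then show ?thesis
      using pow[OF q] by (rule perturb_zeros_near)
  qed
  then have "\<forall>q\<in>Z. \<exists>U. open U \<and> q \<in> U \<and> (\<forall>t x. cmod t \<le> 1 \<longrightarrow> x \<in> U \<longrightarrow>
      x \<in> common_zeros (\<lambda>i. g i + Const t * F i) \<longrightarrow> x \<in> common_zeros g)"
    by blast
  from bchoice[OF this] obtain U where U: "\<And>q. q \<in> Z \<Longrightarrow> open (U q)" "\<And>q. q \<in> Z \<Longrightarrow> q \<in> U q"
    and Uz: "\<And>q t x. q \<in> Z \<Longrightarrow> cmod t \<le> 1 \<Longrightarrow> x \<in> U q \<Longrightarrow>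
      x \<in> common_zeros (\<lambda>i. g i + Const t * F i) \<Longrightarrow> x \<in> common_zeros g"
    by blast
  define C' where "C' = C - (\<Union>q\<in>Z. U q)"
  have "compact C'"
    unfolding C'_def using U by (intro compact_diff C open_UN) auto
  moreover have "C' \<inter> common_zeros g = {}"
    using U(2) Z unfolding C'_def by blast
  ultimately obtain e where e: "0 < e" "\<And>x. x \<in> C' \<Longrightarrow> e \<le> (\<Sum>i\<in>UNIV. cmod (eval_poly (g i) x))"
    using nonzero_on_compact_bound[of C' g] by blast
  obtain M where M: "0 < M" "\<And>x. x \<in> C \<Longrightarrow> (\<Sum>i\<in>UNIV. cmod (eval_poly (F i) x)) < M"
    using bounded_on_compact[OF C, of F] by blast
  have "common_zeros (\<lambda>i. g i + Const (of_real t) * F i) \<inter> C = Z"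
    if t: "0 < t" "t \<le> min 1 (e / M)" for t :: real
  proof (intro equalityI subsetI)
    fix x assume x: "x \<in> common_zeros (\<lambda>i. g i + Const (of_real t) * F i) \<inter> C"
    have "x \<notin> C'"
    proof
      assume "x \<in> C'"
      have "eval_poly (g i) x = - (of_real t * eval_poly (F i) x)" for i
        using x by (auto simp: common_zeros_def eq_neg_iff_add_eq_0)
      then have "(\<Sum>i\<in>UNIV. cmod (eval_poly (g i) x)) = t * (\<Sum>i\<in>UNIV. cmod (eval_poly (F i) x))"
        using t by (simp add: norm_mult sum_distrib_left)
      also have "\<dots> < t * M"
        using x t M by simp
      also have "\<dots> \<le> e"
        using t M by (simp add: pos_le_divide_eq)
      finally show False using e(2)[OF \<open>x \<in> C'\<close>] by simp
    qed
    then obtain q where "q \<in> Z" "x \<in> U q"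
      using x by (auto simp: C'_def)
    then have "x \<in> common_zeros g"
      using Uz[of q "of_real t" x] x t by auto
    then show "x \<in> Z" using x Z by blast
  next
    fix q assume q: "q \<in> Z"
    have "eval_poly (F i) q = 0" for i
      using F[OF q, of i] by (auto simp: dvd_def)
    then show "q \<in> common_zeros (\<lambda>i. g i + Const (of_real t) * F i) \<inter> C"
      using q Z by (auto simp: common_zeros_def)
  qed
  then show ?thesis
    using e M by (intro exI[of _ "min 1 (e / M)"]) auto
qed

lemma length_filter_mem:
  assumes "finite A"
  shows "length (filter (\<lambda>x. x \<in> A) Q) = (\<Sum>a\<in>A. length (filter (\<lambda>x. x = a) Q))"
proof (induction Q)
  case (Cons q Q)
  have "(\<Sum>a\<in>A. length (filter (\<lambda>x. x = a) (q # Q))) =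
      (\<Sum>a\<in>A. (if q = a then 1 else 0) + length (filter (\<lambda>x. x = a) Q))"
    by (intro sum.cong) auto
  then show ?case
    using Cons assms by (simp add: sum.distrib sum.delta')
qed simp

lemma open_contains_closed_polydisc:
  fixes p :: "'n::finite \<Rightarrow> complex"
  assumes "open T" "p \<in> T"
  shows "\<exists>e>0. {x. \<forall>i. cmod (p i - x i) \<le> e} \<subseteq> T"
proof -
  obtain U where U: "\<And>i. open (U i)" "p \<in> PiE UNIV U" "PiE UNIV U \<subseteq> T"
    using assms unfolding open_fun_def openin_product_topology_alt by (metis UNIV_I open_openin)
  then have "\<exists>e>0. cball (p i) e \<subseteq> U i" for i
    using open_contains_cball[of "U i"] by (auto simp: PiE_def)
  then obtain e where e: "\<And>i. e i > 0" "\<And>i. cball (p i) (e i) \<subseteq> U i"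
    by metis
  have "{x. \<forall>i. cmod (p i - x i) \<le> Min (range e)} \<subseteq> PiE UNIV U"
    using e(2) by (force simp: PiE_def Pi_def dist_norm)
  then show ?thesis
    using e(1) U(3) by (intro exI[of _ "Min (range e)"]) auto
qed

lemma multiplicity_conservation:
  fixes g g' :: "'n::finite \<Rightarrow> 'n cpoly" and p :: "'n \<Rightarrow> complex" and e :: real
  defines "P \<equiv> {x. \<forall>i. cmod (p i - x i) < e}" and "C \<equiv> {x. \<forall>i. cmod (p i - x i) \<le> e}"
  assumes g: "\<And>i. degree_lt k (g i)" and g': "\<And>i. degree_lt k (g' i)"
    and p: "common_zeros g \<inter> C = {p}" and mult: "zero_multiplicity g p = enat r"
    and c: "0 < c" "\<And>x s. x \<in> C - P \<Longrightarrow> s \<in> {0..1} \<Longrightarrow>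
      c \<le> (\<Sum>i\<in>UNIV. cmod (eval_poly (g i + Const (of_real s) * (g' i - g i)) x))"
  shows "finite (common_zeros g' \<inter> P) \<and> (\<Sum>q\<in>common_zeros g' \<inter> P. zero_multiplicity g' q) = enat r"
proof -
  have p_zero: "p \<in> common_zeros g" using p by auto
  have C: "compact C" unfolding C_def by (rule compact_closed_polydisc)
  have no_bd: "x \<in> P" if "x \<in> C" "x \<in> common_zeros g \<or> x \<in> common_zeros g'" for x
  proof (rule ccontr)
    assume "x \<notin> P"
    then have x: "x \<in> C - P" using that by simp
    show False
      using that(2) c(2)[OF x, of 0] c(2)[OF x, of 1] c(1) by (auto simp: common_zeros_def)
  qed
  have PC: "P \<subseteq> C" by (auto simp: P_def C_def less_imp_le)
  define Z where "Z = common_zeros g' \<inter> P"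
  have ZC: "common_zeros g' \<inter> C = Z" using no_bd PC by (auto simp: Z_def)
  define V where "V = {x. \<exists>i. e < cmod (p i - x i)}"
  have "open P"
  proof -
    have "P = (\<Inter>i. {x. cmod (p i - x i) < e})" by (auto simp: P_def)
    also have "open \<dots>" by (intro open_INT finite ballI open_Collect_less continuous_intros) simp
    finally show ?thesis .
  qed
  moreover have "open V"
  proof -
    have "V = (\<Union>i. {x. e < cmod (p i - x i)})" by (auto simp: V_def)
    also have "open \<dots>" by (intro open_UN ballI open_Collect_less continuous_intros) simp
    finally show ?thesis .
  qed
  moreover have "x \<notin> V" if "x \<in> P" for x
    using that by (auto simp: P_def V_def not_less less_imp_le)
  then have "P \<inter> V = {}" by blast
  ultimately have PV: "open P" "open V" "P \<inter> V = {}" .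

  obtain Qp where Qp: "comp_series (loc_ideal p (ideal_gen g)) Qp" "length Qp = r"
    using zero_multiplicity_finite[OF p_zero mult] by blast
  have pow_p: "(Var i - Const (p i)) ^ r \<in> loc_ideal p (ideal_gen g)" for i
    using power_in_loc_ideal[OF poly_ideal.subspace_span, of "Var i - Const (p i)" p _ r]
      comp_series_bound[OF Qp(1)] Qp(2) by simp

  define K where "K = Suc (r + k)"
  define F where "F W i = (\<Prod>w\<in>W. (Var i - Const (w i)) ^ K)" for W :: "('n \<Rightarrow> complex) set" and i :: 'n
  have F_dvd: "(Var i - Const (w i)) ^ Suc r dvd F W i" if "finite W" "w \<in> W" for W w i
  proof -
    have "(Var i - Const (w i)) ^ Suc r dvd (Var i - Const (w i)) ^ K"
      by (rule le_imp_power_dvd) (simp add: K_def)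
    also have "\<dots> dvd F W i"
      unfolding F_def by (rule dvd_prodI[OF that])
    finally show ?thesis .
  qed
  have count: "\<exists>t0>0. \<forall>t :: real. 0 < t \<and> t \<le> t0 \<longrightarrow>
      (\<exists>Q. comp_series (ideal_gen (\<lambda>i. g' i + Const (of_real t) * F W i)) Q \<and>
        length (filter (\<lambda>q. q \<in> P) Q) = r)" if W: "finite W" "p \<in> W" for W
  proof -
    obtain t1 where t1: "0 < t1" "\<And>t. 0 < t \<Longrightarrow> t \<le> t1 \<Longrightarrow>
        common_zeros (\<lambda>i. g i + Const (of_real t) * F W i) \<inter> C = {p}"
      using perturbed_zeros_eq[OF C _ p, of r "F W"] F_dvd[OF W] pow_p by auto
    obtain M where M: "0 < M" "\<And>x. x \<in> C \<Longrightarrow> (\<Sum>i\<in>UNIV. cmod (eval_poly (F W i) x)) < M"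
      using bounded_on_compact[OF C, of "F W"] by blast
    define E where "E = K * card W"
    have "k < K" by (simp add: K_def)
    moreover have "0 < card W" using W by (auto simp: card_gt_0_iff)
    then have "K \<le> E" by (simp add: E_def)
    ultimately have E: "0 < E" "k \<le> E" by auto
    have FE: "degree_lt E (F W i - Var i ^ E)" for i
      unfolding F_def E_def by (rule degree_lt_prod_powers[OF W(1)])
    have "\<exists>Q. comp_series (ideal_gen (\<lambda>i. g' i + Const (of_real t) * F W i)) Q \<and>
        length (filter (\<lambda>q. q \<in> P) Q) = r" if t: "0 < t" "t \<le> min t1 (c / M)" for t
    proof -
      have "common_zeros (\<lambda>i. g i + Const (of_real s) * (g' i - g i) + Const (of_real t) * F W i) \<subseteq> P \<union> V"
        if s: "s \<in> {0..1}" for s :: real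
      proof (rule ccontr)
        assume "\<not> ?thesis"
        then obtain x where x: "x \<in> common_zeros (\<lambda>i. g i + Const (of_real s) * (g' i - g i) + Const (of_real t) * F W i)"
          and "x \<notin> P" "x \<notin> V" by blast
        then have xC: "x \<in> C - P"
          by (auto simp: C_def V_def not_less)
        have "eval_poly (g i + Const (of_real s) * (g' i - g i)) x = - (of_real t * eval_poly (F W i) x)" for i
          using x by (simp add: common_zeros_def eq_neg_iff_add_eq_0)
        then have "(\<Sum>i\<in>UNIV. cmod (eval_poly (g i + Const (of_real s) * (g' i - g i)) x)) =
            t * (\<Sum>i\<in>UNIV. cmod (eval_poly (F W i) x))"
          using t by (simp only: norm_minus_cancel norm_mult sum_distrib_left norm_of_real abs_of_pos)
        also have "\<dots> < t * M"
          using xC t M by simp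
        also have "\<dots> \<le> c"
          using t M by (simp add: pos_le_divide_eq)
        finally show False using c(2)[OF xC s] by simp
      qed
      from perturbed_count_eq[OF E(1) FE degree_lt_mono[OF g E(2)] degree_lt_mono[OF g' E(2)] t(1) PV this]
      obtain Q Q' where Q: "comp_series (ideal_gen (\<lambda>i. g i + Const (of_real t) * F W i)) Q"
        and Q': "comp_series (ideal_gen (\<lambda>i. g' i + Const (of_real t) * F W i)) Q'"
        and eq: "length (filter (\<lambda>q. q \<in> P) Q) = length (filter (\<lambda>q. q \<in> P) Q')"
        by blast
      obtain R where "\<And>i. F W i = (Var i - Const (p i)) ^ Suc r * R i"
        using F_dvd[OF W] unfolding dvd_def by metis
      from loc_ideal_perturb[OF this pow_p]
      have "comp_series (loc_ideal p (ideal_gen g)) (filter (\<lambda>q. q = p) Q)"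
        using comp_series_loc[OF Q, of p] by simp
      then have "length (filter (\<lambda>q. q = p) Q) = r"
        using comp_series_length_unique Qp by metis
      moreover have "filter (\<lambda>q. q \<in> P) Q = filter (\<lambda>q. q = p) Q"
        using t1(2)[OF t(1)] t(2) comp_series_set[OF Q] PC no_bd p_zero p
        by (intro filter_cong) auto
      ultimately show ?thesis
        using Q' eq by auto
    qed
    then show ?thesis
      using t1(1) c(1) M(1) by (intro exI[of _ "min t1 (c / M)"]) auto
  qed

  have Z_zero: "q \<in> common_zeros (\<lambda>i. g' i + Const t * F W i)" if "q \<in> Z" "finite W" "q \<in> W" for q t W
  proof -
    have "eval_poly (F W i) q = 0" for i
      using F_dvd[OF that(2,3), of i] by (auto simp: dvd_def)
    then show ?thesis
      using that(1) by (simp add: Z_def common_zeros_def)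
  qed
  have "card A \<le> r" if A: "A \<subseteq> Z" "finite A" for A
  proof -
    obtain t Q where Q: "comp_series (ideal_gen (\<lambda>i. g' i + Const (of_real t) * F (insert p A) i)) Q"
      "length (filter (\<lambda>q. q \<in> P) Q) = r"
      using count[of "insert p A"] A(2) by auto
    have "A \<subseteq> set (filter (\<lambda>q. q \<in> P) Q)"
    proof
      fix x assume "x \<in> A"
      then have "x \<in> Z" using A by blast
      then show "x \<in> set (filter (\<lambda>q. q \<in> P) Q)"
        using Z_zero[of x "insert p A" "of_real t"] \<open>x \<in> A\<close> A(2) comp_series_set[OF Q(1)]
        by (simp add: Z_def)
    qed
    then have "card A \<le> card (set (filter (\<lambda>q. q \<in> P) Q))"
      by (intro card_mono) auto
    then show ?thesis
      using card_length[of "filter (\<lambda>q. q \<in> P) Q"] Q(2) by linarith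
  qed
  then have fin: "finite Z"
    using finite_if_finite_subsets_card_bdd[of Z r] by blast

  define W where "W = insert p Z"
  have W: "finite W" "p \<in> W" "Z \<subseteq> W" using fin by (auto simp: W_def)
  obtain t1 where t1: "0 < t1" "\<And>t. 0 < t \<Longrightarrow> t \<le> t1 \<Longrightarrow>
      \<exists>Q. comp_series (ideal_gen (\<lambda>i. g' i + Const (of_real t) * F W i)) Q \<and>
        length (filter (\<lambda>q. q \<in> P) Q) = r"
    using count[OF W(1,2)] by blast
  have F_Z: "(Var i - Const (q i)) ^ Suc r dvd F W i" if "q \<in> Z" for q i
    using F_dvd[OF W(1)] W(3) that by blast
  have pow: "(Var i - Const (q i)) ^ r \<in> loc_ideal q (ideal_gen g')" if q: "q \<in> Z" for q i
  proof -
    obtain Q where Q: "comp_series (ideal_gen (\<lambda>i. g' i + Const (of_real t1) * F W i)) Q"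
      "length (filter (\<lambda>q. q \<in> P) Q) = r"
      using t1 by blast
    have "length (filter (\<lambda>x. x = q) Q) \<le> r"
    proof -
      have "filter (\<lambda>x. x = q) (filter (\<lambda>x. x \<in> P) Q) = filter (\<lambda>x. x = q) Q"
        using q by (auto simp: Z_def intro!: filter_cong)
      then show ?thesis
        using length_filter_le[of "\<lambda>x. x = q" "filter (\<lambda>x. x \<in> P) Q"] Q(2) by simp
    qed
    then have "(Var i - Const (q i)) ^ r \<in> loc_ideal q (ideal_gen (\<lambda>i. g' i + Const (of_real t1) * F W i))" for i
      using comp_series_bound[OF comp_series_loc[OF Q(1), of q]] le_trans
      by (intro power_in_loc_ideal poly_ideal.subspace_span) (simp, blast)
    moreover obtain R where "\<And>i. F W i = (Var i - Const (q i)) ^ Suc r * R i"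
      using F_Z[OF q] unfolding dvd_def by metis
    ultimately show ?thesis
      using power_in_loc_ideal_unperturb by blast
  qed
  obtain t2 where t2: "0 < t2" "\<And>t. 0 < t \<Longrightarrow> t \<le> t2 \<Longrightarrow>
      common_zeros (\<lambda>i. g' i + Const (of_real t) * F W i) \<inter> C = Z"
    using perturbed_zeros_eq[OF C fin ZC, of r "F W"] F_Z pow by auto
  define t where "t = min t1 t2"
  have t: "0 < t" "t \<le> t1" "t \<le> t2" using t1 t2 by (auto simp: t_def)
  obtain Q where Q: "comp_series (ideal_gen (\<lambda>i. g' i + Const (of_real t) * F W i)) Q"
    "length (filter (\<lambda>q. q \<in> P) Q) = r"
    using t1(2)[OF t(1,2)] by blast
  have mult_q: "zero_multiplicity g' q = enat (length (filter (\<lambda>x. x = q) Q))" if q: "q \<in> Z" for q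
  proof -
    obtain R where "\<And>i. F W i = (Var i - Const (q i)) ^ Suc r * R i"
      using F_Z[OF q] unfolding dvd_def by metis
    from loc_ideal_perturb[OF this pow[OF q]]
    have "comp_series (loc_ideal q (ideal_gen g')) (filter (\<lambda>x. x = q) Q)"
      using comp_series_loc[OF Q(1), of q] by simp
    then show ?thesis
      using zero_multiplicity_comp_series q by (auto simp: Z_def)
  qed
  have "filter (\<lambda>q. q \<in> P) Q = filter (\<lambda>q. q \<in> Z) Q"
    using t2(2)[OF t(1,3)] comp_series_set[OF Q(1)] PC by (intro filter_cong) (auto simp: Z_def)
  then have "r = (\<Sum>q\<in>Z. length (filter (\<lambda>x. x = q) Q))"
    using length_filter_mem[OF fin] Q(2) by simp
  then have "(\<Sum>q\<in>Z. zero_multiplicity g' q) = enat r"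
    by (simp add: mult_q flip: of_nat_eq_enat)
  then show ?thesis
    using fin by (simp add: Z_def)
qed

theorem theorem4p2:
  fixes g :: "'n::finite \<Rightarrow> 'n cpoly"
    and d :: "'n \<Rightarrow> nat"
    and p :: "'n \<Rightarrow> complex"
    and r :: nat
  assumes "\<And>i. total_degree (g i) = d i"
    and "p isolated_in common_zeros g"
    and "zero_multiplicity g p = enat r"
  shows "\<forall>\<epsilon>>0. \<exists>\<epsilon>\<^sub>1 \<delta>\<^sub>1. 0 < \<epsilon>\<^sub>1 \<and> \<epsilon>\<^sub>1 < \<epsilon> \<and> 0 < \<delta>\<^sub>1 \<and>
    (\<forall>a' \<in> polydisc (coeff_index d) (coeff_vector d g) \<delta>\<^sub>1.
       let g' = system_of d a';
           Z = common_zeros g' \<inter> polydisc UNIV p \<epsilon>\<^sub>1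
       in finite Z \<and> (\<Sum>\<xi>\<in>Z. zero_multiplicity g' \<xi>) = enat r)"
proof (intro allI impI)
  fix \<epsilon> :: real assume "0 < \<epsilon>"
  obtain T where T: "open T" "T \<inter> common_zeros g = {p}"
    using assms(2) by (auto simp: isolated_in_def)
  obtain e1 where e1: "0 < e1" "{x. \<forall>i. cmod (p i - x i) \<le> e1} \<subseteq> T"
    using open_contains_closed_polydisc[OF T(1)] T(2) by blast
  define e where "e = min e1 (\<epsilon> / 2)"
  have e: "0 < e" "e < \<epsilon>" using e1 \<open>0 < \<epsilon>\<close> by (auto simp: e_def)
  let ?P = "{x. \<forall>i. cmod (p i - x i) < e}" and ?C = "{x. \<forall>i. cmod (p i - x i) \<le> e}"
  have P: "polydisc UNIV p e = ?P" by (simp add: polydisc_def)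
  have "?C \<subseteq> T" using e1(2) by (auto simp: e_def)
  then have pC: "common_zeros g \<inter> ?C = {p}"
    using T(2) e(1) by auto
  have "compact (?C - ?P)"
  proof -
    have "?P = (\<Inter>i. {x. cmod (p i - x i) < e})" by auto
    also have "open \<dots>" by (intro open_INT finite ballI open_Collect_less continuous_intros) simp
    finally show ?thesis by (intro compact_diff compact_closed_polydisc)
  qed
  moreover have "(?C - ?P) \<inter> common_zeros g = {}"
  proof -
    have "x \<in> ?P" if "x \<in> ?C" "x \<in> common_zeros g" for x
    proof -
      have "x = p" using pC that by blast
      then show ?thesis using e(1) by simp
    qed
    then show ?thesis by blast
  qed
  ultimately obtain c where c: "0 < c" "\<And>x. x \<in> ?C - ?P \<Longrightarrow> c \<le> (\<Sum>i\<in>UNIV. cmod (eval_poly (g i) x))"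
    using nonzero_on_compact_bound[of "?C - ?P" g] by blast
  define M where "M = 1 + e + (\<Sum>i\<in>UNIV. cmod (p i))"
  have "1 \<le> M" using e(1) by (simp add: M_def sum_nonneg)
  have M: "cmod (x i) \<le> M" if "x \<in> ?C" for x i
  proof -
    have "cmod (x i) \<le> cmod (p i) + cmod (p i - x i)"
      by (metis norm_minus_commute norm_triangle_sub)
    moreover have "cmod (p i) \<le> (\<Sum>i\<in>UNIV. cmod (p i))"
      by (rule member_le_sum) auto
    moreover have "cmod (p i - x i) \<le> e" using that by blast
    ultimately show ?thesis by (simp add: M_def)
  qed
  define B where "B = (\<Sum>i\<in>UNIV. card {m :: 'n monom. monom_degree m \<le> d i} * M ^ d i)"
  have "0 \<le> B" using \<open>1 \<le> M\<close> by (auto simp: B_def intro!: sum_nonneg)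
  define \<delta> where "\<delta> = c / (2 * (1 + B))"
  have \<delta>: "0 < \<delta>" "\<delta> * B \<le> c / 2"
    using c(1) \<open>0 \<le> B\<close> by (auto simp: \<delta>_def field_simps)
  have deg_g: "degree_lt (Suc (d i)) (g i)" for i
    using monom_degree_le_total_degree[of _ "g i"] assms(1)[of i] by (auto simp: degree_lt_def less_Suc_eq_le)
  have "finite (common_zeros g' \<inter> ?P) \<and> (\<Sum>\<xi>\<in>common_zeros g' \<inter> ?P. zero_multiplicity g' \<xi>) = enat r"
    if a': "a' \<in> polydisc (coeff_index d) (coeff_vector d g) \<delta>" and g': "g' = system_of d a'" for a' g'
  proof (rule multiplicity_conservation[OF _ _ pC assms(3), where k = "Suc (\<Sum>i\<in>UNIV. d i)" and c = "c / 2"])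
    have deg_g': "degree_lt (Suc (d i)) (g' i)" for i
      by (auto simp: degree_lt_def g' in_keys_iff lookup_system_of less_Suc_eq_le split: if_splits)
    have d: "d i \<le> (\<Sum>i\<in>UNIV. d i)" for i
      by (rule member_le_sum) auto
    show "degree_lt (Suc (\<Sum>i\<in>UNIV. d i)) (g i)" "degree_lt (Suc (\<Sum>i\<in>UNIV. d i)) (g' i)" for i
      using deg_g deg_g' d degree_lt_mono Suc_le_mono by blast+
    show "0 < c / 2" using c(1) by simp
    fix x and s :: real assume x: "x \<in> ?C - ?P" and s: "s \<in> {0..1}"
    have coeff: "cmod (Poly_Mapping.lookup (g' i - g i) m) \<le> \<delta>" for i m
    proof (cases "monom_degree m \<le> d i")
      case True
      then have "(i, m) \<in> coeff_index d" by (simp add: coeff_index_def)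
      then have "cmod (coeff_vector d g (i, m) - a' (i, m)) < \<delta>"
        using a' by (auto simp: polydisc_def)
      then show ?thesis
        using True by (simp add: coeff_vector_def coeff_index_def g' lookup_minus lookup_system_of norm_minus_commute)
    next
      case False
      then have "Poly_Mapping.lookup (g i) m = 0" "Poly_Mapping.lookup (g' i) m = 0"
        using deg_g[of i] deg_g'[of i] by (auto simp: degree_lt_def in_keys_iff less_Suc_eq_le)
      then show ?thesis using \<delta>(1) by (simp add: lookup_minus)
    qed
    have small: "cmod (eval_poly (g' i - g i) x) \<le> \<delta> * (card {m :: 'n monom. monom_degree m \<le> d i} * M ^ d i)" for i
    proof -
      let ?f = "g' i - g i"
      have deg: "degree_lt (Suc (d i)) ?f"
        using degree_lt_add[OF deg_g' degree_lt_Const_mult[OF deg_g, where c = "- 1"]] by (simp add: Const_uminus)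
      have "(\<Sum>m\<in>Poly_Mapping.keys ?f. cmod (Poly_Mapping.lookup ?f m)) \<le>
          (\<Sum>m\<in>{m :: 'n monom. monom_degree m \<le> d i}. \<delta>)"
        using deg \<delta>(1) coeff by (intro sum_le_included[where i = id])
          (auto simp: finite_monoms_degree_le degree_lt_def less_Suc_eq_le)
      then have "(\<Sum>m\<in>Poly_Mapping.keys ?f. cmod (Poly_Mapping.lookup ?f m)) * M ^ d i \<le>
          card {m :: 'n monom. monom_degree m \<le> d i} * \<delta> * M ^ d i"
        using \<open>1 \<le> M\<close> by (intro mult_right_mono) auto
      moreover have "cmod (eval_poly ?f x) \<le> (\<Sum>m\<in>Poly_Mapping.keys ?f. cmod (Poly_Mapping.lookup ?f m)) * M ^ d i"
        using x by (intro eval_poly_degree_lt_bound deg \<open>1 \<le> M\<close> M) auto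
      ultimately show ?thesis by (simp add: mult_ac)
    qed
    have "c \<le> (\<Sum>i\<in>UNIV. cmod (eval_poly (g i) x))"
      using c(2)[OF x] .
    also have "\<dots> \<le> (\<Sum>i\<in>UNIV. cmod (eval_poly (g i + Const (of_real s) * (g' i - g i)) x)
        + \<delta> * (card {m :: 'n monom. monom_degree m \<le> d i} * M ^ d i))"
    proof (rule sum_mono)
      fix i
      have "eval_poly (g i) x = eval_poly (g i + Const (of_real s) * (g' i - g i)) x - of_real s * eval_poly (g' i - g i) x"
        by simp
      then have "cmod (eval_poly (g i) x) \<le> cmod (eval_poly (g i + Const (of_real s) * (g' i - g i)) x)
          + cmod (of_real s * eval_poly (g' i - g i) x)"
        by (metis norm_triangle_ineq4)
      also have "cmod (of_real s * eval_poly (g' i - g i) x) \<le> 1 * cmod (eval_poly (g' i - g i) x)"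
        unfolding norm_mult using s by (intro mult_right_mono) auto
      finally show "cmod (eval_poly (g i) x) \<le> cmod (eval_poly (g i + Const (of_real s) * (g' i - g i)) x)
          + \<delta> * (card {m :: 'n monom. monom_degree m \<le> d i} * M ^ d i)"
        using small[of i] by simp
    qed
    also have "\<dots> = (\<Sum>i\<in>UNIV. cmod (eval_poly (g i + Const (of_real s) * (g' i - g i)) x)) + \<delta> * B"
      by (simp only: sum.distrib B_def sum_distrib_left)
    finally show "c / 2 \<le> (\<Sum>i\<in>UNIV. cmod (eval_poly (g i + Const (of_real s) * (g' i - g i)) x))"
      using \<delta>(2) by linarith
  qed
  then show "\<exists>\<epsilon>\<^sub>1 \<delta>\<^sub>1. 0 < \<epsilon>\<^sub>1 \<and> \<epsilon>\<^sub>1 < \<epsilon> \<and> 0 < \<delta>\<^sub>1 \<and>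
    (\<forall>a' \<in> polydisc (coeff_index d) (coeff_vector d g) \<delta>\<^sub>1.
       let g' = system_of d a';
           Z = common_zeros g' \<inter> polydisc UNIV p \<epsilon>\<^sub>1
       in finite Z \<and> (\<Sum>\<xi>\<in>Z. zero_multiplicity g' \<xi>) = enat r)"
    using e \<delta>(1) unfolding Let_def by (intro exI[of _ e] exI[of _ \<delta>]) (simp add: P)
qed

end
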